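(* Let $n\ge 1$ be an integer and let $\mathcal{G}$ be a non-trivial finite nilpotent group of odd order having no cyclic Sylow subgroups, where $\gcd(n,|\mathcal{G}|)=1$. Let $G=\mathbb{Z}_n\times\mathcal{G}$. Then the non-cyclic graph $\Gamma(G)$ is Hamiltonian.
   Context: For a finite non-cyclic group $G$, $\mathrm{Cyc}(G)=\{x\in G:\langle x,y\rangle\text{ is cyclic for all }y\in G\}$. The non-cyclic graph $\Gamma(G)$ is the simple undirected graph with vertex set $G\setminus\mathrm{Cyc}(G)$ in which two distinct vertices $x,y$ are adjacent if and only if the subgroup $\langle x,y\rangle$ is not cyclic. A graph is Hamiltonian if it contains a cycle passing through all its vertices. "$\mathcal{G}$ has no cyclic Sylow subgroups" means that for every prime $p$ dividing $|\mathcal{G}|$ the Sylow $p$-subgroup of $\mathcal{G}$ is non-cyclic. *)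

theory Defs
  imports "HOL-Algebra.Elementary_Groups" "HOL-Computational_Algebra.Primes"
    "Graph_Theory.Graph_Theory"
begin

section \<open>Nilpotent groups and Sylow subgroups\<close>

text \<open>The subgroup \<open>[H, K]\<close>; the convention for the commutator of two elements is that of
  \<^const>\<open>derived\<close>, so that \<open>derived G H = commutator_subgroup G H H\<close>.\<close>

definition commutator_subgroup ::
    "('a, 'b) monoid_scheme \<Rightarrow> 'a set \<Rightarrow> 'a set \<Rightarrow> 'a set" where
  "commutator_subgroup G H K =
     generate G (\<Union>h\<in>H. \<Union>k\<in>K. {h \<otimes>\<^bsub>G\<^esub> k \<otimes>\<^bsub>G\<^esub> inv\<^bsub>G\<^esub> h \<otimes>\<^bsub>G\<^esub> inv\<^bsub>G\<^esub> k})"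

text \<open>Indexed from 0: \<open>lower_central_series G 0\<close> is the whole group.\<close>

primrec lower_central_series :: "('a, 'b) monoid_scheme \<Rightarrow> nat \<Rightarrow> 'a set" where
  "lower_central_series G 0 = carrier G"
| "lower_central_series G (Suc i) =
     commutator_subgroup G (lower_central_series G i) (carrier G)"

definition nilpotent_group :: "('a, 'b) monoid_scheme \<Rightarrow> bool" where
  "nilpotent_group G \<longleftrightarrow> group G \<and> (\<exists>c. lower_central_series G c = {\<one>\<^bsub>G\<^esub>})"

text \<open>Only meaningful for a finite group \<open>G\<close> and a prime \<open>p\<close>.\<close>

definition sylow_subgroup :: "nat \<Rightarrow> 'a set \<Rightarrow> ('a, 'b) monoid_scheme \<Rightarrow> bool" where
  "sylow_subgroup p P G \<longleftrightarrow> subgroup P G \<and> card P = p ^ multiplicity p (Coset.order G)"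

definition no_cyclic_sylow_subgroups :: "('a, 'b) monoid_scheme \<Rightarrow> bool" where
  "no_cyclic_sylow_subgroups G \<longleftrightarrow>
     (\<forall>p P. Factorial_Ring.prime p \<and> p dvd Coset.order G \<and> sylow_subgroup p P G
        \<longrightarrow> \<not> cyclic_group (subgroup_generated G P))"


section \<open>The non-cyclic graph\<close>

definition cyclicizer :: "('a, 'b) monoid_scheme \<Rightarrow> 'a set" where
  "cyclicizer G =
     {x \<in> carrier G. \<forall>y \<in> carrier G. cyclic_group (subgroup_generated G {x, y})}"

text \<open>An undirected simple graph is a symmetric loop-free pair digraph, as in
  \<^locale>\<open>pair_graph\<close>.\<close>

definition noncyclic_graph :: "('a, 'b) monoid_scheme \<Rightarrow> 'a pair_pre_digraph" where
  "noncyclic_graph G =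
     \<lparr> pverts = carrier G - cyclicizer G,
       parcs = {(x, y). x \<in> carrier G - cyclicizer G \<and> y \<in> carrier G - cyclicizer G \<and>
                  x \<noteq> y \<and> \<not> cyclic_group (subgroup_generated G {x, y})} \<rparr>"

lemma pair_graph_noncyclic_graph:
  assumes "finite (carrier G)"
  shows "pair_graph (noncyclic_graph G)"
proof
  show "finite (pverts (noncyclic_graph G))"
    using assms by (simp add: noncyclic_graph_def)
  show "finite (parcs (noncyclic_graph G))"
    by (rule finite_subset[of _ "carrier G \<times> carrier G"])
       (use assms in \<open>auto simp: noncyclic_graph_def\<close>)
  show "symmetric (with_proj (noncyclic_graph G))"
    by (auto simp: symmetric_def arcs_ends_def arc_to_ends_def sym_def noncyclic_graph_def
        insert_commute)
qed (auto simp: noncyclic_graph_def)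

text \<open>The length bound is needed because \<^const>\<open>pre_digraph.cycle\<close> admits \<open>u, v, u\<close>, which
  traverses a single undirected edge back and forth. The vertices on a closed walk are the
  tails of its arcs.\<close>

definition hamiltonian :: "'a pair_pre_digraph \<Rightarrow> bool" where
  "hamiltonian \<Gamma> \<longleftrightarrow>
     (\<exists>p. pre_digraph.cycle (with_proj \<Gamma>) p \<and> 3 \<le> length p \<and> fst ` set p = pverts \<Gamma>)"

end

(* Two copies (a, x), (b, y) of elements x, y of the nilpotent group H lie in a common cyclic subgroup
   of Z_n x H only if x, y lie in one of H, and the elements (a, 1) are not vertices. So the graph of
   Z_n x H contains the n-fold blow-up of the graph of H on the same vertices, and running n times
   through a Hamiltonian cycle of the latter gives one of the former.

   For H, Posa's criterion is used: whenever 2k is less than the number of vertices and some vertex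
   has degree at most k, fewer than k vertices do. Let a vertex of degree at most k be called low.
   The p-components of two low vertices lie in a common cyclic subgroup, because otherwise their
   cyclic neighbourhoods in the Sylow subgroup P would together have at most |P| elements. Hence all
   p-components of low vertices lie in the cyclic subgroup <d> generated by the largest of them, and
   there are at most |<d>| |H : P| low vertices. On the other hand, for d nontrivial at least
   2 |<d>| elements of P lie in no cyclic subgroup with d, so that k >= 2 |<d>| |H : P|. *)

theory Submission
  imports Defs "HOL-Algebra.Sylow" "HOL-Number_Theory.Residues"
begin

section \<open>Hamiltonian cycles\<close>

text \<open>Degrees can be far below half the number of vertices, so Dirac's bound is out of reach:
  in Z_3 x Z_(3^m) with m >= 2, an element d of order 3 in the second factor is joined to only 6
  elements. This also shows that the bound 2 |<d>| can be attained. Its factor 2 is what yields the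
  strict inequality in Posa's criterion. Oddness guards against the quaternion group, a noncyclic
  2-group whose central involution shares a cyclic subgroup with every element. A single prime
  suffices for each k: any p dividing the order of some low vertex. The projection onto the Sylow
  subgroup P has fibres of constant size |H : P|, so both estimates are made inside P and multiplied
  by the same factor.\<close>

definition ham_cycle :: "'a set \<Rightarrow> ('a \<Rightarrow> 'a \<Rightarrow> bool) \<Rightarrow> 'a list \<Rightarrow> bool" where
  "ham_cycle V A xs \<longleftrightarrow> distinct xs \<and> set xs = V \<and> 3 \<le> length xs \<and>
     successively A xs \<and> A (last xs) (hd xs)"

lemma ham_cycle_rotate:
  assumes "ham_cycle V A (xs @ ys)"
  shows "ham_cycle V A (ys @ xs)"
  using assms unfolding ham_cycle_def
  by (cases "xs = []"; cases "ys = []") (auto simp: successively_append_iff)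

text \<open>Since \<open>A\<close> has no Hamiltonian cycle, one of \<open>A'\<close> must use the
  new edge between \<open>u\<close> and \<open>v\<close>. With that edge rotated to the closing
  position, the list, reversed if necessary, is the wanted path in \<open>A\<close>.\<close>

lemma ham_cycle_delete_edge:
  assumes ham: "ham_cycle V A' xs" and nham: "\<And>ys. \<not> ham_cycle V A ys"
    and A': "\<And>x y. A' x y \<Longrightarrow> A x y \<or> {x, y} = {u, v}"
    and sym: "\<And>x y. A x y \<Longrightarrow> A y x"
  shows "\<exists>ys. distinct ys \<and> set ys = V \<and> 3 \<le> length ys \<and> successively A ys \<and> hd ys = u \<and> last ys = v"
proof -
  have "\<exists>ys. ham_cycle V A' ys \<and> \<not> A (last ys) (hd ys)"
  proof (cases "A (last xs) (hd xs)")
    case True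
    with ham nham[of xs] have "\<not> successively A xs"
      by (auto simp: ham_cycle_def)
    then obtain i where i: "Suc i < length xs" "\<not> A (xs ! i) (xs ! Suc i)"
      by (auto simp: successively_conv_nth)
    define ys where "ys = drop (Suc i) xs @ take (Suc i) xs"
    have "ham_cycle V A' ys"
      unfolding ys_def by (rule ham_cycle_rotate) (simp add: ham)
    moreover have "hd ys = xs ! Suc i" "last ys = xs ! i"
      using i by (auto simp: ys_def hd_append hd_drop_conv_nth last_append take_Suc_conv_app_nth)
    ultimately show ?thesis using i by auto
  qed (use ham in auto)
  then obtain ys where ys: "ham_cycle V A' ys" "\<not> A (last ys) (hd ys)" by blast
  have d: "distinct ys" "3 \<le> length ys" "set ys = V" "ys \<noteq> []"
    using ys by (auto simp: ham_cycle_def)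
  have ends: "{last ys, hd ys} = {u, v}" using ys A' by (auto simp: ham_cycle_def)
  have suc: "successively A ys"
    unfolding successively_conv_nth
  proof (intro allI impI)
    fix i assume i: "Suc i < length ys"
    have "A' (ys ! i) (ys ! Suc i)"
      using ys(1) i by (auto simp: ham_cycle_def successively_conv_nth)
    \<comment> \<open>This pair already closes the list, and the first and last entries of a
      distinct list of length at least 3 are not consecutive.\<close>
    moreover have "{ys ! i, ys ! Suc i} \<noteq> {u, v}"
    proof
      assume "{ys ! i, ys ! Suc i} = {u, v}"
      with ends have "{ys ! i, ys ! Suc i} = {ys ! (length ys - 1), ys ! 0}"
        using d by (simp add: last_conv_nth hd_conv_nth)
      hence "ys ! Suc i = ys ! (length ys - 1) \<and> ys ! i = ys ! 0 \<or> ys ! Suc i = ys ! 0"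
        by (auto simp: doubleton_eq_iff)
      thus False using d i by (auto simp: nth_eq_iff_index_eq)
    qed
    ultimately show "A (ys ! i) (ys ! Suc i)" using A' by blast
  qed
  show ?thesis
  proof (cases "hd ys = u")
    case True
    thus ?thesis using d suc ends by (intro exI[of _ ys]) (auto simp: doubleton_eq_iff)
  next
    case False
    hence "hd ys = v" "last ys = u" using ends by (auto simp: doubleton_eq_iff)
    moreover have "successively A (rev ys)"
      using suc by (auto intro: successively_mono sym)
    ultimately show ?thesis using d
      by (intro exI[of _ "rev ys"]) (auto simp: hd_rev last_rev)
  qed
qed

text \<open>Ore's crossing argument: if the first vertex is adjacent to \<open>xs ! Suc i\<close>
  and the last one to \<open>xs ! i\<close>, reversing the part after position \<open>i\<close>
  closes the path to a cycle. So the index sets \<open>S\<close> and \<open>T\<close> of the two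
  neighbourhoods are disjoint, and there are only \<open>n - 1\<close> positions for both.\<close>

lemma ham_path_degree_sum:
  assumes nham: "\<And>zs. \<not> ham_cycle V A zs"
    and xs: "distinct xs" "set xs = V" "3 \<le> length xs" "successively A xs"
    and sym: "\<And>x y. A x y \<Longrightarrow> A y x" and irr: "\<And>x. \<not> A x x"
  shows "card {y\<in>V. A (hd xs) y} + card {y\<in>V. A (last xs) y} < card V"
proof -
  define n where "n = length xs"
  have n: "3 \<le> n" "xs \<noteq> []" using xs by (auto simp: n_def)
  have hl: "hd xs = xs ! 0" "last xs = xs ! (n - 1)"
    using n by (auto simp: hd_conv_nth last_conv_nth n_def)
  define S where "S = {i. i < n - 1 \<and> A (hd xs) (xs ! Suc i)}"
  define T where "T = {i. i < n - 1 \<and> A (last xs) (xs ! i)}"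
  have "S \<inter> T = {}"
  proof (rule ccontr)
    assume "S \<inter> T \<noteq> {}"
    then obtain i where i: "i < n - 1" "A (hd xs) (xs ! Suc i)" "A (last xs) (xs ! i)"
      by (auto simp: S_def T_def)
    define as bs where "as = take (Suc i) xs" and "bs = drop (Suc i) xs"
    have ab0: "xs = as @ bs" by (simp add: as_def bs_def)
    have ab: "as \<noteq> []" "bs \<noteq> []" "last as = xs ! i" "hd bs = xs ! Suc i"
      using i n by (auto simp: as_def bs_def n_def take_Suc_conv_app_nth hd_drop_conv_nth)

    have 1: "hd as = hd xs" "last bs = last xs" using ab0 ab by auto
    have s: "successively A as" "successively A bs"
      using xs(4) ab ab0 by (auto simp: successively_append_iff)
    have "successively A (rev bs)" using s(2) by (auto intro: successively_mono sym)
    hence "successively A (as @ rev bs)"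
      using s ab i 1 by (auto simp: successively_append_iff hd_rev intro: sym)
    moreover have "A (last (as @ rev bs)) (hd (as @ rev bs))"
      using ab i 1 by (auto simp: last_rev intro: sym)
    ultimately have "ham_cycle V A (as @ rev bs)"
      using xs unfolding ham_cycle_def by (auto simp: ab0)
    thus False using nham by blast
  qed
  moreover have "finite S" "finite T" by (auto simp: S_def T_def)
  ultimately have "card S + card T = card (S \<union> T)" by (simp add: card_Un_disjoint)
  also have "\<dots> \<le> card {..<n - 1}" by (intro card_mono) (auto simp: S_def T_def)
  finally have st: "card S + card T \<le> n - 1" by simp
  have "{y\<in>V. A (hd xs) y} \<subseteq> (\<lambda>i. xs ! Suc i) ` S"
  proof
    fix y assume y: "y \<in> {y\<in>V. A (hd xs) y}"
    then obtain i where i: "i < n" "y = xs ! i" using xs by (auto simp: in_set_conv_nth n_def)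
    have "i \<noteq> 0" using y i irr hl by (intro notI) auto
    thus "y \<in> (\<lambda>i. xs ! Suc i) ` S"
      using i y by (intro image_eqI[of _ _ "i - 1"]) (auto simp: S_def)
  qed
  hence 1: "card {y\<in>V. A (hd xs) y} \<le> card S" using \<open>finite S\<close> by (meson surj_card_le)
  have "{y\<in>V. A (last xs) y} \<subseteq> (\<lambda>i. xs ! i) ` T"
  proof
    fix y assume y: "y \<in> {y\<in>V. A (last xs) y}"
    then obtain i where i: "i < n" "y = xs ! i" using xs by (auto simp: in_set_conv_nth n_def)
    have "i \<noteq> n - 1" using y i irr hl by (intro notI) auto
    thus "y \<in> (\<lambda>i. xs ! i) ` T"
      using i y by (intro image_eqI[of _ _ "i"]) (auto simp: T_def)
  qed
  hence 2: "card {y\<in>V. A (last xs) y} \<le> card T" using \<open>finite T\<close> by (meson surj_card_le)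
  have "card V = n" using xs distinct_card n_def by metis
  with 1 2 st n show ?thesis by linarith
qed

lemma ham_cycle_complete:
  assumes "finite V" "3 \<le> card V" and A: "\<And>x y. x \<in> V \<Longrightarrow> y \<in> V \<Longrightarrow> x \<noteq> y \<Longrightarrow> A x y"
  shows "\<exists>xs. ham_cycle V A xs"
proof -
  obtain xs where xs: "set xs = V" "distinct xs" using finite_distinct_list[OF assms(1)] by blast
  have l: "3 \<le> length xs" using xs assms distinct_card by metis
  have "successively A xs"
    unfolding successively_conv_nth using xs A by (auto simp: nth_eq_iff_index_eq)
  moreover have "A (last xs) (hd xs)"
  proof (rule A)
    show "last xs \<in> V" "hd xs \<in> V" using l xs by (auto intro: last_in_set list.set_sel(1))
    have "xs ! (length xs - 1) \<noteq> xs ! 0" using l xs by (subst nth_eq_iff_index_eq) auto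
    thus "last xs \<noteq> hd xs" using l by (cases "xs = []") (auto simp: last_conv_nth hd_conv_nth)
  qed
  ultimately show ?thesis using xs l by (auto simp: ham_cycle_def)
qed

text \<open>In an edge-maximal non-Hamiltonian supergraph choose non-adjacent \<open>u\<close>, \<open>v\<close> with
  \<open>d u \<le> d v\<close> and \<open>d u + d v\<close> maximal. This sum is less than the number of vertices, so \<open>v\<close> has at
  least \<open>d u\<close> non-neighbours, and these all have degree at most \<open>d u\<close>.\<close>

theorem posa_hamiltonian:
  assumes fin: "finite V" and V3: "3 \<le> card V"
    and sym: "\<And>x y. A x y \<Longrightarrow> A y x" and irr: "\<And>x. \<not> A x x"
    and posa: "\<And>k x. \<lbrakk>2 * k < card V; x \<in> V; card {y\<in>V. A x y} \<le> k\<rbrakk>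
                 \<Longrightarrow> card {x\<in>V. card {y\<in>V. A x y} \<le> k} < k"
  shows "\<exists>xs. ham_cycle V A xs"
proof (rule ccontr)
  assume nham: "\<nexists>xs. ham_cycle V A xs"
  define A0 where "A0 = {(x, y) \<in> V \<times> V. A x y}"
  define F where "F = {B. A0 \<subseteq> B \<and> B \<subseteq> V \<times> V \<and> Relation.sym B \<and> irrefl B \<and> (\<nexists>xs. ham_cycle V (\<lambda>x y. (x, y) \<in> B) xs)}"
  have "finite F" by (rule finite_subset[of _ "Pow (V \<times> V)"]) (use fin in \<open>auto simp: F_def\<close>)
  moreover have "A0 \<in> F"
  proof -
    have "\<not> ham_cycle V (\<lambda>x y. (x, y) \<in> A0) xs" for xs
    proof
      assume h: "ham_cycle V (\<lambda>x y. (x, y) \<in> A0) xs"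
      have "successively A xs"
        using h unfolding ham_cycle_def by (auto intro: successively_mono simp: A0_def)
      with h nham show False by (auto simp: ham_cycle_def A0_def)
    qed
    thus ?thesis using sym irr by (auto simp: F_def A0_def Relation.sym_def irrefl_def)
  qed
  ultimately obtain B where B: "B \<in> F" "A0 \<subseteq> B" and Bmax: "\<And>C. C \<in> F \<Longrightarrow> B \<subseteq> C \<Longrightarrow> B = C"
    using finite_has_maximal2[of F A0] by metis
  have Bsub: "B \<subseteq> V \<times> V" and Bsym: "(x, y) \<in> B \<Longrightarrow> (y, x) \<in> B" and Birr: "(x, x) \<notin> B"
    and Bn: "\<And>xs. \<not> ham_cycle V (\<lambda>x y. (x, y) \<in> B) xs" for x y
    using B by (auto simp: F_def Relation.sym_def irrefl_def)
  define d where "d x = card {y\<in>V. (x, y) \<in> B}" for x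
  define W where "W = {(u, v) \<in> V \<times> V. u \<noteq> v \<and> (u, v) \<notin> B}"
  have Wd: "d u + d v < card V" if uv: "(u, v) \<in> W" for u v
  proof -
    define B' where "B' = insert (u, v) (insert (v, u) B)"
    have "B' \<notin> F" using Bmax[of B'] uv by (auto simp: B'_def W_def)
    moreover have "A0 \<subseteq> B'" "B' \<subseteq> V \<times> V" "Relation.sym B'" "irrefl B'"
      using B Bsub Bsym Birr uv by (auto simp: B'_def W_def Relation.sym_def irrefl_def)
    ultimately obtain xs where "ham_cycle V (\<lambda>x y. (x, y) \<in> B') xs" by (auto simp: F_def)
    from ham_cycle_delete_edge[OF this Bn, of u v] obtain ys where
      "distinct ys" "set ys = V" "3 \<le> length ys" "successively (\<lambda>x y. (x, y) \<in> B) ys" "hd ys = u" "last ys = v"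
      using Bsym by (auto simp: B'_def)
    from ham_path_degree_sum[OF Bn this(1-4)] this Bsym Birr show ?thesis by (auto simp: d_def)
  qed
  have "W \<noteq> {}" using ham_cycle_complete[OF fin V3, of "\<lambda>x y. (x, y) \<in> B"] Bn by (auto simp: W_def)
  moreover have finW: "finite W" by (rule finite_subset[of _ "V \<times> V"]) (use fin in \<open>auto simp: W_def\<close>)
  ultimately have "Max ((\<lambda>(u, v). d u + d v) ` W) \<in> (\<lambda>(u, v). d u + d v) ` W"
    by (intro Max_in) auto
  then obtain u' v' where uv': "(u', v') \<in> W" "Max ((\<lambda>(u, v). d u + d v) ` W) = d u' + d v'" by auto
  have m': "(u', v') \<in> W" "\<And>x y. (x, y) \<in> W \<Longrightarrow> d x + d y \<le> d u' + d v'"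
    using uv' finW by (auto simp: uv'(2)[symmetric] intro!: Max_ge)
  obtain u v where uv: "(u, v) \<in> W" "d u \<le> d v" "\<And>x y. (x, y) \<in> W \<Longrightarrow> d x + d y \<le> d u + d v"
  proof (cases "d u' \<le> d v'")
    case True thus ?thesis using that m' by blast
  next
    case False
    moreover have "(v', u') \<in> W" using m'(1) Bsym by (auto simp: W_def)
    ultimately show ?thesis using that[of v' u'] m' by (auto simp: add.commute)
  qed
  define k where "k = d u"
  have k2: "2 * k < card V" using Wd[OF uv(1)] uv(2) by (simp add: k_def)
  have V: "u \<in> V" "v \<in> V" using uv by (auto simp: W_def)
  have le: "card {y\<in>V. A x y} \<le> d x" if "x \<in> V" for x
    unfolding d_def by (rule card_mono) (use that fin B in \<open>auto simp: A0_def\<close>)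
  have "V - {v} - {y\<in>V. (v, y) \<in> B} \<subseteq> {x\<in>V. d x \<le> k}"
  proof
    fix x assume "x \<in> V - {v} - {y\<in>V. (v, y) \<in> B}"
    hence "(x, v) \<in> W" using V Bsym by (auto simp: W_def)
    from uv(3)[OF this] show "x \<in> {x\<in>V. d x \<le> k}" using \<open>(x, v) \<in> W\<close> by (auto simp: k_def W_def)
  qed
  hence "card (V - {v} - {y\<in>V. (v, y) \<in> B}) \<le> card {x\<in>V. d x \<le> k}"
    by (intro card_mono) (use fin in auto)
  \<comment> \<open>Passing to the supergraph \<open>B\<close> only raises degrees, so vertices of
    small degree in \<open>B\<close> have small degree in \<open>A\<close>.\<close>
  also have "\<dots> \<le> card {x\<in>V. card {y\<in>V. A x y} \<le> k}"
    by (intro card_mono) (use fin le in \<open>auto intro: order_trans\<close>)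
  \<comment> \<open>The vertex \<open>u\<close> is the witness that \<open>posa\<close> asks for.
    The witness makes the criterion satisfiable at \<open>k = 0\<close>, where no set has fewer than
    \<open>k\<close> elements.\<close>
  also have "\<dots> < k" using posa[OF k2 V(1)] le[OF V(1)] by (simp add: k_def)
  also have "card (V - {v} - {y\<in>V. (v, y) \<in> B}) = card V - 1 - d v"
    using fin V Birr by (subst card_Diff_subset) (auto simp: d_def)
  finally show False using Wd[OF uv(1)] by (simp add: k_def)
qed

section \<open>From vertex lists to cycles of arcs, and blow-ups\<close>

lemma pcas_successively:
  assumes "xs \<noteq> []"
  shows "pcas (hd xs) (zip xs (tl xs @ [z])) z"
  using assms by (induction xs rule: induct_list012) (auto)

lemma set_zip_successively:
  assumes "successively P xs" "xs \<noteq> []" "P (last xs) z"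
  shows "set (zip xs (tl xs @ [z])) \<subseteq> {(x, y). P x y}"
  using assms by (induction xs rule: induct_list012) auto

lemma hamiltonian_if_ham_cycle:
  assumes ham: "ham_cycle (pverts \<Gamma>) (\<lambda>x y. (x, y) \<in> parcs \<Gamma>) xs"
  shows "hamiltonian \<Gamma>"
proof -
  have xs: "xs \<noteq> []" "distinct xs" "set xs = pverts \<Gamma>" "3 \<le> length xs"
    using ham by (auto simp: ham_cycle_def)
  define p where "p = zip xs (tl xs @ [hd xs])"
  have len: "length p = length xs" using xs by (simp add: p_def)
  have m: "map fst p = xs" "map snd p = tl xs @ [hd xs]" using xs by (auto simp: p_def)
  interpret pair_pre_digraph \<Gamma> .
  have cas: "pcas (hd xs) p (hd xs)" unfolding p_def using xs by (intro pcas_successively) auto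
  have "set p \<subseteq> parcs \<Gamma>"
    using set_zip_successively[of "\<lambda>x y. (x, y) \<in> parcs \<Gamma>" xs "hd xs"] ham xs
    by (auto simp: ham_cycle_def p_def)
  hence "pre_digraph.awalk (with_proj \<Gamma>) (hd xs) p (hd xs)"
    using cas xs by (auto simp: pre_digraph.awalk_def)
  moreover have "pre_digraph.awalk_verts (with_proj \<Gamma>) (hd xs) p = hd xs # tl xs @ [hd xs]"
    using pre_digraph.awalk_verts_conv'[of "with_proj \<Gamma>" "hd xs" p "hd xs"] cas m len xs
    by (auto simp: neq_Nil_conv)
  moreover have "distinct (tl xs @ [hd xs])" using xs by (cases xs) auto
  moreover have "fst ` set p = pverts \<Gamma>" using m(1) xs by (metis list.set_map)
  ultimately show ?thesis unfolding hamiltonian_def pre_digraph.cycle_def using xs len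
    by (intro exI[of _ p] conjI exI[of _ "hd xs"]) auto
qed

text \<open>In \<open>List.product\<close> the first coordinate is the slow one. Each block is a
  copy of the path \<open>xs\<close>; the step to the next block, and from the last block back to
  the first, is a copy of the closing edge from \<open>last xs\<close> to
  \<open>hd xs\<close>.\<close>

lemma ham_cycle_blow_up:
  assumes "ham_cycle V A xs" "n \<ge> 1"
    and B: "\<And>a b x y. \<lbrakk>a < n; b < n; x \<in> V; y \<in> V; A x y\<rbrakk> \<Longrightarrow> B (f a, x) (f b, y)"
    and inj: "inj_on f {..<n}"
  shows "ham_cycle (f ` {..<n} \<times> V) B (List.product (map f [0..<n]) xs)"
proof -
  have xs: "xs \<noteq> []" "distinct xs" "set xs = V" "3 \<le> length xs" "successively A xs" "A (last xs) (hd xs)"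
    using assms by (auto simp: ham_cycle_def)
  have *: "successively B (List.product (map f [0..<m]) xs) \<and>
         last (List.product (map f [0..<m]) xs) = (f (m - 1), last xs) \<and>
         hd (List.product (map f [0..<m]) xs) = (f 0, hd xs)" if "1 \<le> m" "m \<le> n" for m
    using that
  proof (induction m rule: nat_induct_at_least)
    case base
    have "successively (\<lambda>x y. B (f 0, x) (f 0, y)) xs"
      using xs base by (auto intro!: B intro: successively_mono)
    thus ?case using xs by (auto simp: successively_map last_map hd_map)
  next
    case (Suc m)
    have "successively (\<lambda>x y. B (f m, x) (f m, y)) xs"
      using xs Suc by (auto intro!: B intro: successively_mono)
    moreover have "List.product (map f [0..<m]) xs \<noteq> []" using Suc xs by (cases "[0..<m]"; cases xs) auto
    moreover have "B (f (m - 1), last xs) (f m, hd xs)" using Suc xs by (intro B) auto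
    moreover have "List.product (map f [0..<Suc m]) xs = List.product (map f [0..<m]) xs @ map (Pair (f m)) xs"
      by (simp add: product_concat_map)
    ultimately show ?case using xs Suc
      by (auto simp: successively_append_iff successively_map last_map hd_map hd_append)
  qed
  have "3 \<le> n * length xs" using xs assms(2) by (cases n) auto
  with *[OF assms(2)] xs assms(2) inj show ?thesis
    unfolding ham_cycle_def
    by (auto simp: distinct_map atLeast0LessThan intro!: distinct_product B)
qed

section \<open>Common cyclic subgroups in finite groups\<close>

lemma coprime_inverse_exponent:
  fixes m n :: nat
  assumes "coprime m n" "m > 0"
  obtains u v where "m * u = n * v + 1"
  using bezout_nat[of m n] assms that by (auto simp: coprime_iff_gcd_eq_1)

locale finite_group = group G for G (structure) +
  assumes fin: "finite (carrier G)"
begin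

text \<open>Natural exponents reach inverses because the group is finite, so this is the cyclic
  subgroup generated by \<open>x\<close>.\<close>

definition powers :: "'a \<Rightarrow> 'a set" where
  "powers x = range (\<lambda>k::nat. x [^] k)"

lemma powers_eq_generate: "x \<in> carrier G \<Longrightarrow> powers x = generate G {x}"
  using generate_pow_on_finite_carrier[OF fin] by (auto simp: powers_def)

lemma subgroup_powers: "x \<in> carrier G \<Longrightarrow> subgroup (powers x) G"
  by (simp add: powers_eq_generate generate_is_subgroup)

lemma powers_self: "x \<in> carrier G \<Longrightarrow> x \<in> powers x"
  unfolding powers_def by (rule image_eqI[of _ _ 1]) auto

lemma pow_in_powers: "x [^] (k::nat) \<in> powers x"
  by (auto simp: powers_def)

lemma pow_in_subgroup: "\<lbrakk>subgroup K G; x \<in> K\<rbrakk> \<Longrightarrow> x [^] (k::nat) \<in> K"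
  by (induction k) (auto simp: subgroup.one_closed subgroup.m_closed)

lemma powers_subset: "\<lbrakk>subgroup K G; x \<in> K\<rbrakk> \<Longrightarrow> powers x \<subseteq> K"
  by (auto simp: powers_def pow_in_subgroup)

lemma powers_mono: "\<lbrakk>y \<in> powers x; x \<in> carrier G\<rbrakk> \<Longrightarrow> powers y \<subseteq> powers x"
  by (simp add: powers_subset subgroup_powers)

lemma card_powers: "x \<in> carrier G \<Longrightarrow> card (powers x) = ord x"
  by (simp add: powers_eq_generate generate_pow_card)

lemma finite_subgroup: "subgroup K G \<Longrightarrow> finite K"
  using fin finite_subset subgroup.subset by blast

lemma ord_positive: "x \<in> carrier G \<Longrightarrow> 0 < ord x"
  using ord_ge_1[OF fin] by force

lemma pow_period:
  assumes "x \<in> carrier G" "x [^] (m::nat) = \<one>"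
  shows "x [^] (m * v + k) = x [^] (k::nat)"
proof -
  have "x [^] (m * v + k) = (x [^] m) [^] v \<otimes> x [^] k"
    using assms(1) by (simp flip: nat_pow_mult nat_pow_pow)
  thus ?thesis using assms by simp
qed

lemma subgroup_finiteI:
  assumes "K \<subseteq> carrier G" "\<one> \<in> K" "\<And>x y. \<lbrakk>x \<in> K; y \<in> K\<rbrakk> \<Longrightarrow> x \<otimes> y \<in> K"
  shows "subgroup K G"
proof
  fix x assume x: "x \<in> K"
  have p: "x [^] (k::nat) \<in> K" for k by (induction k) (use assms x in auto)
  have "x [^] (ord x - 1) \<otimes> x = x [^] (Suc (ord x - 1))" by simp
  also have "\<dots> = \<one>" using ord_positive[of x] assms x by (metis Suc_diff_1 pow_ord_eq_1 subsetD)
  finally have "inv x = x [^] (ord x - 1)" using assms x by (intro inv_equality) auto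
  thus "inv x \<in> K" using p by simp
qed (use assms in auto)

lemma card_subgroup_dvd:
  assumes "subgroup L G" "subgroup K G" "L \<subseteq> K"
  shows "card L dvd card K"
proof -
  interpret K: group "G\<lparr>carrier := K\<rparr>" using assms subgroup_imp_group by blast
  have "subgroup L (G\<lparr>carrier := K\<rparr>)" using assms by (simp add: subgroup_incl)
  from K.lagrange[OF this] have "card K = card L * card (rcosets\<^bsub>G\<lparr>carrier := K\<rparr>\<^esub> L)"
    by (simp add: Coset.order_def mult.commute)
  thus ?thesis by simp
qed

definition p_element :: "nat \<Rightarrow> 'a \<Rightarrow> bool" where
  "p_element p x \<longleftrightarrow> x \<in> carrier G \<and> (\<exists>a. x [^] (p ^ a) = \<one>)"

text \<open>Equivalent, for group elements, to cyclicity of the subgroup generated by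
  \<open>x\<close> and \<open>y\<close>. Asking only for some cyclic overgroup makes the relation
  pass at once to powers and to projections of a direct product.\<close>

definition cocyclic :: "'a \<Rightarrow> 'a \<Rightarrow> bool" where
  "cocyclic x y \<longleftrightarrow> (\<exists>g\<in>carrier G. x \<in> powers g \<and> y \<in> powers g)"

lemma cocyclic_sym: "cocyclic x y \<Longrightarrow> cocyclic y x"
  by (auto simp: cocyclic_def)

lemma cocyclic_refl: "x \<in> carrier G \<Longrightarrow> cocyclic x x"
  by (auto simp: cocyclic_def intro: powers_self)

lemma cocyclic_commute: "cocyclic x y \<Longrightarrow> x \<otimes> y = y \<otimes> x"
  by (auto simp: cocyclic_def powers_def nat_pow_mult add.commute)

lemma cocyclic_powers: "\<lbrakk>x \<in> powers y; y \<in> carrier G\<rbrakk> \<Longrightarrow> cocyclic x y"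
  by (auto simp: cocyclic_def intro: powers_self)

lemma powers_pow_coprime:
  assumes "x \<in> carrier G" "x [^] (n::nat) = \<one>" "coprime m n"
  shows "x \<in> powers (x [^] (m::nat))"
proof (cases "m = 0")
  case True
  with assms have "x = \<one>" by simp
  thus ?thesis by (auto simp: powers_def)
next
  case False
  then obtain u v where "m * u = n * v + 1" using coprime_inverse_exponent assms by blast
  hence "(x [^] m) [^] u = x" using assms pow_period[of x n v 1] by (simp add: nat_pow_pow)
  thus ?thesis by (metis pow_in_powers)
qed

lemma pow_prime_power_gcd:
  assumes "g \<in> carrier G" "g [^] (n::nat) = \<one>" "n > 0"
  shows "g [^] gcd i n \<in> powers (g [^] i)"
proof (cases "i = 0")
  case False
  then obtain u v where "i * u = n * v + gcd i n" using bezout_nat by metis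
  hence "(g [^] i) [^] u = g [^] gcd i n" using assms pow_period[of g n v] by (simp add: nat_pow_pow)
  thus ?thesis by (metis pow_in_powers)
qed (use assms in \<open>auto simp: powers_def\<close>)

text \<open>The subgroups of a cyclic \<open>p\<close>-group form a chain: \<open>g [^] i\<close>
  generates the same subgroup as its power with exponent \<open>gcd i (p ^ a)\<close>, and the
  divisors of \<open>p ^ a\<close> are linearly ordered by divisibility.\<close>

lemma p_element_powers_linear:
  assumes p: "Factorial_Ring.prime p" and g: "p_element p g" and xy: "x \<in> powers g" "y \<in> powers g"
  shows "x \<in> powers y \<or> y \<in> powers x"
proof -
  obtain a where a: "g \<in> carrier G" "g [^] (p ^ a) = \<one>" using g by (auto simp: p_element_def)
  have pa: "p ^ a > 0" using p by (simp add: prime_gt_0_nat)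
  obtain i j where ij: "x = g [^] (i::nat)" "y = g [^] (j::nat)" using xy by (auto simp: powers_def)
  have *: "g [^] j \<in> powers (g [^] i)" if d: "gcd i (p ^ a) dvd gcd j (p ^ a)" for i j
  proof -
    obtain k where "j = gcd i (p ^ a) * k" using d by (meson dvd_def dvd_trans gcd_dvd1)
    hence "g [^] j = (g [^] gcd i (p ^ a)) [^] k" using a by (simp add: nat_pow_pow)
    moreover have "powers (g [^] gcd i (p ^ a)) \<subseteq> powers (g [^] i)"
      using pow_prime_power_gcd[OF a pa] a by (intro powers_mono) auto
    ultimately show ?thesis using pow_in_powers by auto
  qed
  obtain b c where "gcd i (p ^ a) = p ^ b" "gcd j (p ^ a) = p ^ c"
    using divides_primepow_nat[OF p] by (meson gcd_dvd2)
  hence "gcd i (p ^ a) dvd gcd j (p ^ a) \<or> gcd j (p ^ a) dvd gcd i (p ^ a)"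
    by (simp add: le_imp_power_dvd) (meson le_imp_power_dvd nat_le_linear)
  thus ?thesis using * ij by blast
qed

text \<open>A common generator \<open>g\<close> need not be a \<open>p\<close>-element. Replacing it
  by \<open>g [^] r\<close>, with \<open>r\<close> the part of \<open>ord g\<close> prime to
  \<open>p\<close>, loses none of the \<open>p\<close>-elements in \<open>powers g\<close>.\<close>

lemma cocyclic_p_element:
  assumes p: "Factorial_Ring.prime p" and xy: "p_element p x" "p_element p y" and c: "cocyclic x y"
  shows "x \<in> powers y \<or> y \<in> powers x"
proof -
  obtain g where g: "g \<in> carrier G" "x \<in> powers g" "y \<in> powers g" using c by (auto simp: cocyclic_def)
  obtain a r where ar: "ord g = p ^ a * r" "\<not> p dvd r"
    using multiplicity_decompose'[of "ord g" p] ord_positive[OF g(1)] p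
    by (metis not_gr_zero not_prime_unit)
  have "p_element p (g [^] r)"
    unfolding p_element_def using g ar
    by (auto simp: nat_pow_pow intro!: exI[of _ a]) (metis mult.commute pow_ord_eq_1)
  moreover have "z \<in> powers (g [^] r)" if z: "p_element p z" "z \<in> powers g" for z
  proof -
    obtain i where i: "z = g [^] (i::nat)" using z by (auto simp: powers_def)
    obtain b where "z [^] (p ^ b) = \<one>" using z by (auto simp: p_element_def)
    hence "ord g dvd i * p ^ b" using g i by (simp add: nat_pow_pow pow_eq_id)
    hence "r dvd i * p ^ b" using ar by (metis dvd_trans dvd_triv_right)
    moreover have "coprime r (p ^ b)" using ar p
      by (simp add: coprime_commute prime_imp_coprime)
    ultimately have "r dvd i" using coprime_dvd_mult_left_iff by blast
    then obtain k where "i = r * k" by (auto simp: dvd_def)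
    hence "z = (g [^] r) [^] k" using i g by (simp add: nat_pow_pow)
    thus ?thesis using pow_in_powers by simp
  qed
  ultimately show ?thesis using p_element_powers_linear[OF p] xy g by blast
qed

text \<open>The two sets meet inside \<open>I = \<langle>c\<rangle> \<inter> \<langle>c'\<rangle>\<close>, and the coset \<open>c c' I\<close> avoids
  both of them.\<close>

lemma card_cocyclic_sum_le:
  assumes p: "Factorial_Ring.prime p" and P: "subgroup P G" "\<And>x. x \<in> P \<Longrightarrow> p_element p x"
    and c: "c \<in> P" "c' \<in> P" "\<not> cocyclic c c'"
  shows "card {y\<in>P. cocyclic c y} + card {y\<in>P. cocyclic c' y} \<le> card P"
proof -
  interpret P: subgroup P G by fact
  note inc = P.subset[THEN subsetD]
  have cc: "c \<in> carrier G" "c' \<in> carrier G" using c inc by auto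
  define I where "I = powers c \<inter> powers c'"
  let ?A = "{y\<in>P. cocyclic c y}" and ?B = "{y\<in>P. cocyclic c' y}" and ?J = "(\<lambda>i. (c \<otimes> c') \<otimes> i) ` I"
  have I: "I \<subseteq> P" using powers_subset[OF P(1)] c by (auto simp: I_def)
  have fP: "finite P" using P(1) finite_subgroup by blast
  have fI: "finite I" using I fP finite_subset by blast
  have AB: "?A \<inter> ?B \<subseteq> I"
  proof
    fix y assume y: "y \<in> ?A \<inter> ?B"
    hence 1: "c \<in> powers y \<or> y \<in> powers c" "c' \<in> powers y \<or> y \<in> powers c'"
      using cocyclic_p_element[OF p P(2)[OF c(1)], of y] cocyclic_p_element[OF p P(2)[OF c(2)], of y] P(2)[of y] y by blast+
    \<comment> \<open>Three of the four combinations put \<open>c\<close> and \<open>c'\<close> into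
      one cyclic subgroup, namely that of \<open>y\<close>, \<open>c\<close> or \<open>c'\<close>;
      the fourth is membership in \<open>I\<close>.\<close>
    have "\<not> (c \<in> powers y \<and> c' \<in> powers y)" using c(3) y inc by (auto simp: cocyclic_def)
    moreover have "\<not> (y \<in> powers c \<and> c' \<in> powers y)"
      using c(3) cc powers_mono[of y c] cocyclic_powers cocyclic_sym by blast
    moreover have "\<not> (y \<in> powers c' \<and> c \<in> powers y)"
      using c(3) cc powers_mono[of y c'] cocyclic_powers by blast
    ultimately show "y \<in> I" using 1 by (auto simp: I_def)
  qed
  \<comment> \<open>A cyclic subgroup containing \<open>c\<close> contains all of \<open>I\<close>.
    If it also contained \<open>c \<otimes> c' \<otimes> i\<close>, cancelling would put
    \<open>c'\<close> into it; likewise with \<open>c\<close> and \<open>c'\<close>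
    exchanged.\<close>
  have "\<not> cocyclic c y \<and> \<not> cocyclic c' y \<and> y \<in> P" if yJ: "y \<in> ?J" for y
  proof -
    obtain i where i: "i \<in> I" "y = c \<otimes> c' \<otimes> i" using yJ by blast
    have ic: "i \<in> P" using i I by auto
    have iG: "i \<in> carrier G" using ic inc by simp
    have yi: "y \<otimes> inv i = c \<otimes> c'" unfolding i(2) using cc iG by (simp add: m_assoc)
    have False if "cocyclic c y"
    proof -
      from that obtain g where g: "g \<in> carrier G" "c \<in> powers g" "y \<in> powers g" by (auto simp: cocyclic_def)
      interpret g: subgroup "powers g" G using subgroup_powers g by simp
      have ig: "i \<in> powers g" using i powers_mono[OF g(2,1)] by (auto simp: I_def)
      have "c' = inv c \<otimes> (y \<otimes> inv i)" unfolding yi using cc by (simp flip: m_assoc)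
      hence "c' \<in> powers g" using g ig by auto
      thus False using g c by (auto simp: cocyclic_def)
    qed
    moreover have False if "cocyclic c' y"
    proof -
      from that obtain g where g: "g \<in> carrier G" "c' \<in> powers g" "y \<in> powers g" by (auto simp: cocyclic_def)
      interpret g: subgroup "powers g" G using subgroup_powers g by simp
      have ig: "i \<in> powers g" using i powers_mono[OF g(2,1)] by (auto simp: I_def)
      have "c = (y \<otimes> inv i) \<otimes> inv c'" unfolding yi using cc by (simp add: m_assoc)
      hence "c \<in> powers g" using g ig by auto
      thus False using g c by (auto simp: cocyclic_def)
    qed
    ultimately show ?thesis using i ic c by auto
  qed
  hence J: "?J \<inter> (?A \<union> ?B) = {}" "?J \<subseteq> P" by auto
  have "I \<subseteq> carrier G" using I P.subset by blast
  hence "inj_on (\<lambda>i. (c \<otimes> c') \<otimes> i) I" using cc by (intro inj_onI) (simp add: subset_iff)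
  hence cJ: "card ?J = card I" by (rule card_image)
  have f: "finite ?J" "finite ?A" "finite ?B" using fI fP by simp_all
  have "card ?J + card (?A \<union> ?B) = card (?J \<union> (?A \<union> ?B))"
    using card_Un_disjoint[of ?J "?A \<union> ?B"] f J(1) by (simp only: finite_Un simp_thms)
  also have "\<dots> \<le> card P" by (rule card_mono[OF fP]) (use J(2) in blast)
  finally have "card I + card (?A \<union> ?B) \<le> card P" by (simp only: cJ)
  moreover have "card (?A \<inter> ?B) \<le> card I" by (rule card_mono[OF fI AB])
  moreover have "card ?A + card ?B = card (?A \<union> ?B) + card (?A \<inter> ?B)"
    by (rule card_Un_Int[OF f(2,3)])
  ultimately show ?thesis by linarith
qed

end

section \<open>Nilpotent groups\<close>

text \<open>Modulo \<open>p * p\<close> the \<open>i\<close>-th term is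
  \<open>1 + i * p * u\<close>, and for odd \<open>p\<close> the sum of the indices is itself a
  multiple of \<open>p\<close>. For \<open>p = 2\<close>, \<open>u = 1\<close> the sum is 4, which
  is not twice an odd number.\<close>

lemma geometric_sum_cong:
  fixes p u :: nat
  assumes "odd p"
  shows "\<exists>v. (\<Sum>i<p. (1 + p * u) ^ i) = p * (1 + p * v)"
proof -
  have 1: "\<exists>e. (1 + p * u) ^ i = 1 + i * p * u + p * p * e" for i
  proof (induction i)
    case (Suc i)
    then obtain e where "(1 + p * u) ^ i = 1 + i * p * u + p * p * e" by blast
    hence "(1 + p * u) ^ Suc i = 1 + Suc i * p * u + p * p * (i * u * u + e + p * u * e)"
      by (simp add: algebra_simps)
    thus ?case by blast
  qed (auto intro: exI[of _ 0])
  then obtain e where e: "\<And>i. (1 + p * u) ^ i = 1 + i * p * u + p * p * e i" by metis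
  obtain q where q: "p = 2 * q + 1" using assms by (auto elim: oddE)
  have "(\<Sum>i<p. i) = p * q"
    using q by (simp add: lessThan_Suc_atMost atMost_atLeast0 gauss_sum_nat)
  have "(\<Sum>i<p. (1 + p * u) ^ i) = p + (\<Sum>i<p. i) * (p * u) + p * p * (\<Sum>i<p. e i)"
    unfolding e by (simp only: sum.distrib sum_distrib_left sum_distrib_right mult.assoc
        sum_constant card_lessThan of_nat_id mult_1_right)
  also have "\<dots> = p * (1 + p * (q * u + (\<Sum>i<p. e i)))"
    unfolding \<open>(\<Sum>i<p. i) = p * q\<close> by (simp add: algebra_simps)
  finally show ?thesis by blast
qed

context group
begin

lemma pow_commute:
  assumes "x \<in> carrier G" "y \<in> carrier G" "x \<otimes> y = y \<otimes> x"
  shows "x [^] (k::nat) \<otimes> y = y \<otimes> x [^] k"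
proof (induction k)
  case (Suc k)
  have "x [^] Suc k \<otimes> y = x [^] k \<otimes> (y \<otimes> x)" using assms by (simp add: m_assoc)
  also have "\<dots> = y \<otimes> x [^] Suc k" using Suc assms by (simp flip: m_assoc)
  finally show ?case .
qed (use assms in auto)

text \<open>Since the commutator \<open>c\<close> of \<open>x\<close> and \<open>z\<close> commutes
  with both, \<open>x [^] j\<close> and \<open>z\<close> have commutator \<open>c [^] j\<close>, and
  so have \<open>x\<close> and \<open>z [^] j\<close>. Hence the order of \<open>c\<close> divides
  both \<open>m\<close> and \<open>n\<close>.\<close>

lemma coprime_central_commutator_trivial:
  assumes c: "x \<in> carrier G" "z \<in> carrier G" "c \<in> carrier G"
    and comm: "x \<otimes> z = c \<otimes> z \<otimes> x" "c \<otimes> x = x \<otimes> c" "c \<otimes> z = z \<otimes> c"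
    and pow: "x [^] (m::nat) = \<one>" "z [^] (n::nat) = \<one>" "coprime m n"
  shows "c = \<one>"
proof -
  have 1: "x [^] j \<otimes> z = c [^] j \<otimes> z \<otimes> x [^] j" for j :: nat
  proof (induction j)
    case (Suc j)
    have "x [^] Suc j \<otimes> z = x [^] j \<otimes> (x \<otimes> z)" using c by (simp add: m_assoc)
    also have "\<dots> = x [^] j \<otimes> c \<otimes> z \<otimes> x" using c comm by (simp add: m_assoc)
    also have "\<dots> = c \<otimes> (x [^] j \<otimes> z) \<otimes> x"
      using c comm(2) pow_commute[of x c j] by (simp add: m_assoc)
    also have "\<dots> = (c \<otimes> c [^] j) \<otimes> z \<otimes> (x [^] j \<otimes> x)" using c Suc by (simp add: m_assoc)
    also have "\<dots> = c [^] Suc j \<otimes> z \<otimes> x [^] Suc j" using c nat_pow_Suc2[of c j] by simp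
    finally show ?case .
  qed (use c in auto)
  have 2: "x \<otimes> z [^] j = c [^] j \<otimes> z [^] j \<otimes> x" for j :: nat
  proof (induction j)
    case (Suc j)
    have "x \<otimes> z [^] Suc j = (x \<otimes> z [^] j) \<otimes> z" using c by (simp add: m_assoc)
    also have "\<dots> = c [^] j \<otimes> z [^] j \<otimes> (x \<otimes> z)" using c Suc by (simp add: m_assoc)
    also have "\<dots> = c [^] j \<otimes> (z [^] j \<otimes> c) \<otimes> z \<otimes> x" using c comm by (simp add: m_assoc)
    also have "\<dots> = c [^] j \<otimes> (c \<otimes> z [^] j) \<otimes> z \<otimes> x" using c comm(3) pow_commute[of z c j] by simp
    also have "\<dots> = c [^] Suc j \<otimes> z [^] Suc j \<otimes> x" using c by (simp add: m_assoc)
    finally show ?case .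
  qed (use c in auto)
  have "c [^] m = \<one>" using 1[of m] pow c by simp
  moreover have "c [^] n = \<one>" using 2[of n] pow c by simp
  ultimately have "ord c dvd m" "ord c dvd n" using c by (simp_all add: pow_eq_id)
  hence "ord c = 1" using pow(3) by (metis coprime_common_divisor_nat)
  thus ?thesis using pow_ord_eq_1[OF c(3)] c(3) by simp
qed

lemma commutator_subgroup_normal:
  assumes "N \<lhd> G"
  shows "commutator_subgroup G N (carrier G) \<lhd> G"
  unfolding commutator_subgroup_def
proof (rule normal_generateI)
  interpret N: normal N G by fact
  show "(\<Union>h\<in>N. \<Union>k\<in>carrier G. {h \<otimes> k \<otimes> inv h \<otimes> inv k}) \<subseteq> carrier G"
    using N.subset by auto
  fix h g assume g: "g \<in> carrier G"
  assume "h \<in> (\<Union>h\<in>N. \<Union>k\<in>carrier G. {h \<otimes> k \<otimes> inv h \<otimes> inv k})"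
  then obtain x k where x: "x \<in> N" "k \<in> carrier G" "h = x \<otimes> k \<otimes> inv x \<otimes> inv k" by auto
  have xc: "x \<in> carrier G" using x N.subset by auto
  have "inv g \<otimes> (g \<otimes> y) = y" if "y \<in> carrier G" for y using g that by (simp flip: m_assoc)
  hence "g \<otimes> h \<otimes> inv g = (g \<otimes> x \<otimes> inv g) \<otimes> (g \<otimes> k \<otimes> inv g) \<otimes> inv (g \<otimes> x \<otimes> inv g) \<otimes> inv (g \<otimes> k \<otimes> inv g)"
    using x(2,3) xc g by (simp add: m_assoc inv_mult_group)
  moreover have "g \<otimes> x \<otimes> inv g \<in> N" using x g N.inv_op_closed2 by simp
  ultimately show "g \<otimes> h \<otimes> inv g \<in> (\<Union>h\<in>N. \<Union>k\<in>carrier G. {h \<otimes> k \<otimes> inv h \<otimes> inv k})"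
    using x(2) g by (metis (no_types, lifting) UN_I inv_closed m_closed singletonI)
qed

lemma lower_central_series_normal: "lower_central_series G i \<lhd> G"
proof (induction i)
  case 0
  show ?case by (rule normal_invI) (auto intro: subgroup_self)
qed (simp add: commutator_subgroup_normal)

lemma commutator_in_lower_central_series:
  assumes "x \<in> lower_central_series G i" "k \<in> carrier G"
  shows "x \<otimes> k \<otimes> inv x \<otimes> inv k \<in> lower_central_series G (Suc i)"
  unfolding lower_central_series.simps commutator_subgroup_def
  by (rule generate.incl) (use assms in auto)

text \<open>The commutator of \<open>x\<close> and \<open>z\<close> descends through the whole lower
  central series: once it lies in one term, it is central modulo the next, and in that quotient the
  coprime exponents make it trivial.\<close>

lemma nilpotent_coprime_commute:
  assumes nil: "nilpotent_group G" and c: "x \<in> carrier G" "z \<in> carrier G"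
    and pow: "x [^] (m::nat) = \<one>" "z [^] (n::nat) = \<one>" "coprime m n"
  shows "x \<otimes> z = z \<otimes> x"
proof -
  define c where "c = x \<otimes> z \<otimes> inv x \<otimes> inv z"
  have cG: "c \<in> carrier G" using c by (simp add: c_def)
  have "c \<in> lower_central_series G i" for i
  proof (induction i)
    case (Suc i)
    define N where "N = lower_central_series G (Suc i)"
    interpret N: normal N G unfolding N_def by (rule lower_central_series_normal)
    interpret Q: group "G Mod N" by (rule N.factorgroup_is_group)
    have hom: "(\<lambda>a. N #> a) \<in> hom G (G Mod N)" by (rule N.r_coset_hom_Mod)
    interpret h: group_hom G "G Mod N" "\<lambda>a. N #> a" using hom by unfold_locales
    have comm: "(N #> c) \<otimes>\<^bsub>G Mod N\<^esub> (N #> a) = (N #> a) \<otimes>\<^bsub>G Mod N\<^esub> (N #> c)" if a: "a \<in> carrier G" for a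
    proof -
      have "c \<otimes> a \<otimes> inv c \<otimes> inv a \<in> N"
        unfolding N_def using Suc a by (rule commutator_in_lower_central_series)
      hence "N #> (c \<otimes> a \<otimes> inv c \<otimes> inv a) = N"
        using cG a by (simp add: coset_join2 N.is_subgroup)
      hence "N #> ((c \<otimes> a \<otimes> inv c \<otimes> inv a) \<otimes> (a \<otimes> c)) = N #> (a \<otimes> c)"
        using cG a N.subset by (metis coset_mult_assoc inv_closed m_closed)
      moreover have "(c \<otimes> a \<otimes> inv c \<otimes> inv a) \<otimes> (a \<otimes> c) = c \<otimes> a"
        using cG a by (metis inv_closed inv_solve_right l_inv m_assoc m_closed r_one)
      ultimately have "N #> (c \<otimes> a) = N #> (a \<otimes> c)"
        by simp
      thus ?thesis using cG a by (metis h.hom_mult)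
    qed
    have "c \<otimes> z \<otimes> x = x \<otimes> z" using c by (simp add: c_def m_assoc)
    hence "(N #> x) \<otimes>\<^bsub>G Mod N\<^esub> (N #> z) = (N #> c) \<otimes>\<^bsub>G Mod N\<^esub> (N #> z) \<otimes>\<^bsub>G Mod N\<^esub> (N #> x)"
      using c cG by (metis h.hom_mult m_closed)
    hence "N #> c = \<one>\<^bsub>G Mod N\<^esub>"
      using c cG comm pow
      by (intro Q.coprime_central_commutator_trivial[of "N #> x" "N #> z" "N #> c" m n])
         (simp_all flip: h.hom_nat_pow)
    hence "N #> c = N" by (simp add: FactGroup_def)
    hence "c \<in> N" using cG coset_join1[OF _ cG N.is_subgroup] by simp
    thus ?case by (simp only: N_def)
  qed (use cG in auto)
  moreover obtain k where "lower_central_series G k = {\<one>}" using nil by (auto simp: nilpotent_group_def)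
  ultimately have "c = \<one>" by blast
  hence "x \<otimes> z \<otimes> inv x = z" using c by (simp add: c_def) (metis inv_closed inv_equality inv_inv m_closed)
  thus ?thesis using c by (metis inv_solve_right' m_closed)
qed

text \<open>Take \<open>y\<close> in the last term of the lower central series that meets \<open>D\<close> outside \<open>C\<close>.\<close>

lemma nilpotent_normalizer_grows:
  assumes nil: "nilpotent_group G" and C: "subgroup C G" and D: "subgroup D G" and CD: "C \<subset> D"
  obtains y where "y \<in> D" "y \<notin> C" "\<And>c. c \<in> C \<Longrightarrow> y \<otimes> c \<otimes> inv y \<in> C"
proof -
  interpret C: subgroup C G by fact
  interpret D: subgroup D G by fact
  define Q where "Q i \<longleftrightarrow> lower_central_series G i \<inter> D \<subseteq> C" for i
  obtain k where "lower_central_series G k = {\<one>}" using nil by (auto simp: nilpotent_group_def)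
  hence k: "Q k" by (auto simp: Q_def)
  have "\<not> Q 0" using CD D.subset by (auto simp: Q_def)
  then obtain i where i: "\<not> Q i" "Q (Suc i)" using k
    nat_induct[of "\<lambda>i. \<not> Q i" k] by blast
  then obtain y where y: "y \<in> lower_central_series G i" "y \<in> D" "y \<notin> C" by (auto simp: Q_def)
  have "y \<otimes> c \<otimes> inv y \<in> C" if c: "c \<in> C" for c
  proof -
    have cc: "c \<in> carrier G" "y \<in> carrier G" "c \<in> D" using c y CD by auto
    have "y \<otimes> c \<otimes> inv y \<otimes> inv c \<in> lower_central_series G (Suc i)"
      using y cc by (intro commutator_in_lower_central_series) auto
    moreover have "y \<otimes> c \<otimes> inv y \<otimes> inv c \<in> D" using y cc by simp
    ultimately have "y \<otimes> c \<otimes> inv y \<otimes> inv c \<in> C" using i by (auto simp: Q_def)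
    hence "y \<otimes> c \<otimes> inv y \<otimes> inv c \<otimes> c \<in> C" using c by simp
    thus ?thesis using cc by (simp add: m_assoc)
  qed
  thus ?thesis using y that by blast
qed

end

section \<open>Noncyclic p-groups of odd order\<close>

context finite_group
begin

lemma conjugate_pow:
  assumes "x \<in> carrier G" "y \<in> carrier G"
  shows "y \<otimes> x [^] (k::nat) \<otimes> inv y = (y \<otimes> x \<otimes> inv y) [^] k"
proof (induction k)
  case (Suc k)
  have "inv y \<otimes> (y \<otimes> x) = x" using assms by (simp flip: m_assoc)
  hence "(y \<otimes> x [^] k \<otimes> inv y) \<otimes> (y \<otimes> x \<otimes> inv y) = y \<otimes> x [^] Suc k \<otimes> inv y"
    using assms by (simp add: m_assoc) (simp flip: m_assoc)
  thus ?case using Suc by simp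
qed (use assms in auto)

lemma conjugation_closed_pow:
  assumes "subgroup C G" "y \<in> carrier G" and y: "\<And>c. c \<in> C \<Longrightarrow> y \<otimes> c \<otimes> inv y \<in> C" and "c \<in> C"
  shows "y [^] (k::nat) \<otimes> c \<otimes> inv (y [^] k) \<in> C"
proof (induction k)
  case (Suc k)
  interpret C: subgroup C G by fact
  have cG: "c \<in> carrier G" using assms C.subset by auto
  have "y [^] Suc k \<otimes> c \<otimes> inv (y [^] Suc k) = y \<otimes> (y [^] k \<otimes> c \<otimes> inv (y [^] k)) \<otimes> inv y"
    unfolding nat_pow_Suc2[OF assms(2)] using cG assms(2) by (simp add: inv_mult_group m_assoc)
  thus ?case using y[OF Suc] by simp
next
  case 0
  have "c \<in> carrier G" using assms subgroup.subset by blast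
  thus ?case using assms by simp
qed

lemma ord_eq_1D: "\<lbrakk>x \<in> carrier G; ord x = 1\<rbrakk> \<Longrightarrow> x = \<one>"
  using pow_eq_id[of x 1] by simp

lemma order_dvd_of_pow_eq:
  assumes "x \<in> carrier G" "x [^] (m::nat) = x [^] (k::nat)" "k \<le> m"
  shows "ord x dvd m - k"
proof -
  have "x [^] (m - k) \<otimes> x [^] k = \<one> \<otimes> x [^] k"
    using assms by (simp add: nat_pow_mult)
  hence "x [^] (m - k) = \<one>" using assms(1) by (subst (asm) right_cancel) auto
  thus ?thesis using assms pow_eq_id by blast
qed

text \<open>Moving a \<open>y\<close> to the right past a power of \<open>x\<close> multiplies the
  exponent by \<open>s\<close>; the geometric sum collects these factors.\<close>

lemma pow_mult_of_conjugate_pow: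
  assumes x: "x \<in> carrier G" and y: "y \<in> carrier G" and s: "y \<otimes> x \<otimes> inv y = x [^] (s::nat)"
  shows "(x [^] (j::nat) \<otimes> y) [^] m = x [^] (j * (\<Sum>i<m. s ^ i)) \<otimes> y [^] m"
proof (induction m)
  case (Suc m)
  have sum: "(\<Sum>i<Suc m. s ^ i) = 1 + s * (\<Sum>i<m. s ^ i)"
    by (subst sum.lessThan_Suc_shift) (simp add: sum_distrib_left)
  have yx: "y \<otimes> x [^] k = x [^] (s * k) \<otimes> y" for k :: nat
  proof -
    have "y \<otimes> x [^] k = (y \<otimes> x [^] k \<otimes> inv y) \<otimes> y" using x y by (simp add: m_assoc)
    thus ?thesis using conjugate_pow[OF x y, of k] x by (simp add: s nat_pow_pow)
  qed
  have "(x [^] j \<otimes> y) [^] Suc m = x [^] j \<otimes> (y \<otimes> x [^] (j * (\<Sum>i<m. s ^ i))) \<otimes> y [^] m"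
    using x y Suc by (subst nat_pow_Suc2) (auto simp: m_assoc)
  also have "\<dots> = x [^] (j + s * (j * (\<Sum>i<m. s ^ i))) \<otimes> (y \<otimes> y [^] m)"
    unfolding yx using x y by (simp add: nat_pow_mult[symmetric] m_assoc)
  also have "y \<otimes> y [^] m = y [^] Suc m" using y nat_pow_Suc2 by metis
  also have "j + s * (j * (\<Sum>i<m. s ^ i)) = j * (\<Sum>i<Suc m. s ^ i)"
    unfolding sum by (simp add: algebra_simps)
  finally show ?case .
qed (use x y in auto)

lemma generator_mem_powers_of_prime_order:
  fixes p :: nat
  assumes p: "Factorial_Ring.prime p" and w: "w \<in> carrier G" "w [^] p = \<one>" and d: "d \<in> powers w" "d \<noteq> \<one>"
  shows "w \<in> powers d"
proof -
  obtain i where i: "d = w [^] (i::nat)" using d by (auto simp: powers_def)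
  have "\<not> p dvd i"
  proof
    assume "p dvd i"
    hence "ord w dvd i" using w pow_eq_id dvd_trans by blast
    thus False using i d w pow_eq_id by blast
  qed
  hence "coprime i p" using prime_imp_coprime[OF p] coprime_commute by blast
  from powers_pow_coprime[OF w this] show ?thesis using i by simp
qed

text \<open>In a non-cyclic \<open>p\<close>-group of odd order, let \<open>x\<close> be an element of maximal order. Some
  \<open>y \<notin> \<langle>x\<rangle>\<close> with \<open>y\<^sup>p \<in> \<langle>x\<rangle>\<close> normalises \<open>\<langle>x\<rangle>\<close>, and multiplying it with a suitable power of
  \<open>x\<close> gives an element of order \<open>p\<close>, because \<open>1 + s + \<dots> + s\<^sup>p\<^sup>-\<^sup>1\<close> is \<open>p\<close> times a unit modulo a
  power of \<open>p\<close> whenever \<open>s\<close> is congruent to 1 modulo the odd prime \<open>p\<close>.\<close>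

lemma noncyclic_pgroup_prime_order_element:
  assumes nil: "nilpotent_group G" and p: "Factorial_Ring.prime p" "odd p"
    and D: "subgroup D G" "\<And>x. x \<in> D \<Longrightarrow> p_element p x" "\<And>g. g \<in> D \<Longrightarrow> D \<noteq> powers g"
    and x: "x \<in> D" "\<And>z. z \<in> D \<Longrightarrow> ord z \<le> ord x"
  obtains w where "w \<in> D" "w [^] p = \<one>" "w \<notin> powers x"
proof -
  interpret D: subgroup D G by fact
  note inc = D.subset[THEN subsetD]
  have xG: "x \<in> carrier G" using x inc by auto
  define C where "C = powers x"
  have C: "subgroup C G" "C \<subset> D" "C \<noteq> D"
    using subgroup_powers[OF xG] powers_subset[OF D(1) x(1)] D(3)[OF x(1)] by (auto simp: C_def)
  interpret C: subgroup C G by fact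
  obtain y0 where y0: "y0 \<in> D" "y0 \<notin> C" "\<And>c. c \<in> C \<Longrightarrow> y0 \<otimes> c \<otimes> inv y0 \<in> C"
    using nilpotent_normalizer_grows[OF nil C(1) D(1) C(2)] by blast
  have y0G: "y0 \<in> carrier G" using y0 inc by auto
  obtain a where "y0 [^] (p ^ a) = \<one>" using D(2)[OF y0(1)] by (auto simp: p_element_def)
  hence "y0 [^] (p ^ a) \<in> C" by simp
  moreover have "y0 [^] (p ^ 0) \<notin> C" using y0 y0G by simp
  ultimately obtain i where i: "y0 [^] (p ^ i) \<notin> C" "y0 [^] (p ^ Suc i) \<in> C"
    using nat_induct[of "\<lambda>i. y0 [^] (p ^ i) \<notin> C" a] by blast
  define y where "y = y0 [^] (p ^ i)"
  have y: "y \<in> D" "y \<notin> C" "y [^] p \<in> C"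
    using i y0 y0G pow_in_subgroup[OF D(1)] by (auto simp: y_def nat_pow_pow mult.commute)
  have yG: "y \<in> carrier G" using y inc by auto
  have "y \<otimes> x \<otimes> inv y \<in> C" unfolding y_def
    using y0G y0 powers_self[OF xG] by (intro conjugation_closed_pow[OF C(1)]) (auto simp: C_def)
  then obtain s where s: "y \<otimes> x \<otimes> inv y = x [^] (s::nat)" by (auto simp: C_def powers_def)
  obtain t where t: "y [^] p = x [^] (t::nat)" using y by (auto simp: C_def powers_def)
  obtain n where n: "x [^] (p ^ n) = \<one>" using D(2)[OF x(1)] by (auto simp: p_element_def)
  \<comment> \<open>Otherwise \<open>y [^] p\<close> would generate \<open>powers x\<close>, so
    \<open>powers y\<close> would properly contain it, against the maximal order of
    \<open>x\<close>.\<close>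
  have "p dvd t"
  proof (rule ccontr)
    assume "\<not> p dvd t"
    hence "coprime t (p ^ n)" using prime_imp_coprime[OF p(1)] coprime_commute coprime_power_right_iff by blast
    from powers_pow_coprime[OF xG n this] have "x \<in> powers (y [^] p)" by (simp add: t)
    hence "x \<in> powers y" using powers_mono[of "y [^] p" y] pow_in_powers yG by blast
    hence "C \<subset> powers y" using powers_mono[of x y] yG y powers_self[OF yG] by (auto simp: C_def)
    hence "card C < card (powers y)"
      using finite_subgroup[OF subgroup_powers[OF yG]] by (intro psubset_card_mono)
    thus False using x(2)[OF y(1)] card_powers xG yG by (simp add: C_def)
  qed
  then obtain t' where t': "t = p * t'" by (auto simp: dvd_def)
  have x1: "x \<noteq> \<one>"
  proof
    assume "x = \<one>"
    hence "ord y \<le> 1" using x(2)[OF y(1)] by simp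
    hence "ord y = 1" using ord_positive[OF yG] by simp
    hence "y = \<one>" by (rule ord_eq_1D[OF yG])
    thus False using y by simp
  qed
  have "ord x dvd p ^ n" using n xG pow_eq_id by blast
  then obtain k where k: "ord x = p ^ k" using divides_primepow_nat[OF p(1)] by blast
  moreover have "k \<noteq> 0" using x1 ord_eq_1D[OF xG] k by (intro notI) simp
  ultimately have px: "p dvd ord x" by simp
  \<comment> \<open>Conjugation by \<open>y [^] k\<close> raises \<open>x\<close> to the power
    \<open>s ^ k\<close>. For \<open>k = p\<close> it is conjugation by a power of \<open>x\<close>,
    hence trivial, so \<open>s ^ p\<close> is 1 modulo \<open>ord x\<close> and thus modulo
    \<open>p\<close>. Fermat's little theorem then gives the same for \<open>s\<close>.\<close>
  have "x [^] (s ^ k) = y [^] k \<otimes> x \<otimes> inv (y [^] k)" for k :: nat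
  proof (induction k)
    case (Suc k)
    have "x [^] (s ^ Suc k) = (y \<otimes> x \<otimes> inv y) [^] (s ^ k)"
      using xG by (simp add: s nat_pow_pow)
    also have "\<dots> = y \<otimes> (y [^] k \<otimes> x \<otimes> inv (y [^] k)) \<otimes> inv y"
      by (simp only: conjugate_pow[OF xG yG, symmetric] Suc)
    also have "\<dots> = y [^] Suc k \<otimes> x \<otimes> inv (y [^] Suc k)"
      unfolding nat_pow_Suc2[OF yG] using xG yG by (simp add: inv_mult_group m_assoc)
    finally show ?case .
  qed (use xG in auto)
  hence "x [^] (s ^ p) = x [^] t \<otimes> x \<otimes> inv (x [^] t)" by (simp add: t)
  also have "\<dots> = x [^] (1::nat)" using xG pow_commute[of x x t] by (simp add: m_assoc)
  finally have sp: "x [^] (s ^ p) = x [^] (1::nat)" .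
  \<comment> \<open>This keeps the truncated subtractions \<open>s - 1\<close> and
    \<open>s ^ p - 1\<close> faithful.\<close>
  have s0: "s \<noteq> 0"
  proof
    assume "s = 0"
    hence "x [^] (1::nat) = \<one>" using sp p by (simp add: power_0_left prime_gt_0_nat)
    thus False using x1 xG by simp
  qed
  have "p dvd s ^ p - 1" using order_dvd_of_pow_eq[OF xG sp] s0 px by (simp add: Suc_le_eq dvd_trans)
  hence sp1: "[s ^ p = 1] (mod p)" using s0 by (simp add: cong_altdef_nat Suc_leI)
  have ps: "\<not> p dvd s"
  proof
    assume "p dvd s"
    hence "p dvd s ^ p" using prime_gt_0_nat[OF p(1)] by (meson dvd_power dvd_trans)
    hence "p dvd 1" using cong_dvd_iff[OF sp1] by blast
    thus False using p by simp
  qed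
  have "[s * s ^ (p - 1) = s * 1] (mod p)"
    using fermat_theorem[OF p(1) ps] by (rule cong_scalar_left)
  moreover have "s * s ^ (p - 1) = s ^ p" using prime_gt_0_nat[OF p(1)] by (simp flip: power_Suc)
  ultimately have "[s = 1] (mod p)" using sp1 by (simp add: cong_def)
  hence "p dvd s - 1" using s0 by (simp add: cong_altdef_nat Suc_leI)
  then obtain u where "s - 1 = p * u" by (auto simp: dvd_def)
  hence u: "s = 1 + p * u" using s0 by simp
  obtain v where v: "(\<Sum>i<p. s ^ i) = p * (1 + p * v)" using geometric_sum_cong[OF p(2)] u by blast
  have "coprime (1 + p * v) p"
    by (rule coprimeI) (metis dvd_add_left_iff dvd_mult2)
  hence "coprime (1 + p * v) (p ^ n)" by simp
  then obtain b q where bq: "(1 + p * v) * b = p ^ n * q + 1"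
    using coprime_inverse_exponent[of "1 + p * v" "p ^ n"] by auto
  \<comment> \<open>The exponent solves \<open>j * (1 + p * v) = - t'\<close> modulo
    \<open>p ^ n\<close>: \<open>b\<close> inverts \<open>1 + p * v\<close>, and
    \<open>p ^ n - 1\<close> stands for -1. This makes the exponent of \<open>x\<close> in
    \<open>w [^] p\<close>, which is \<open>p * (j * (1 + p * v) + t')\<close>, vanish modulo
    \<open>p ^ n\<close>.\<close>
  define j where "j = b * t' * (p ^ n - 1)"
  define w where "w = x [^] j \<otimes> y"
  have "p ^ n dvd j * (1 + p * v) + t'"
  proof -
    obtain N where N: "p ^ n = Suc N" using prime_gt_0_nat[OF p(1)] by (metis gr0_implies_Suc zero_less_power)
    have "j * (1 + p * v) + t' = t' * N * ((1 + p * v) * b) + t'" by (simp add: j_def N algebra_simps)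
    also have "\<dots> = p ^ n * (t' * N * q + t')" unfolding bq by (simp add: N algebra_simps)
    finally show ?thesis by simp
  qed
  then obtain r where r: "j * (1 + p * v) + t' = p ^ n * r" by (auto simp: dvd_def)
  have "w [^] p = x [^] (j * (\<Sum>i<p. s ^ i) + t)"
    using pow_mult_of_conjugate_pow[OF xG yG s] xG by (simp add: w_def t nat_pow_mult)
  also have "j * (\<Sum>i<p. s ^ i) + t = p ^ n * (r * p) + 0"
  proof -
    have "j * (p * (1 + p * v)) + p * t' = p * (j * (1 + p * v) + t')" by (simp add: algebra_simps)
    thus ?thesis unfolding v t' r by simp
  qed
  also have "x [^] (p ^ n * (r * p) + 0) = \<one>" using pow_period[OF xG n, of "r * p" 0] by simp
  finally have wp: "w [^] p = \<one>" .
  have wD: "w \<in> D" using x y pow_in_subgroup[OF D(1)] by (simp add: w_def)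
  have "w \<notin> C"
  proof
    assume "w \<in> C"
    moreover have "x [^] j \<in> C" by (simp add: C_def pow_in_powers)
    ultimately have "inv (x [^] j) \<otimes> w \<in> C" by simp
    moreover have "inv (x [^] j) \<otimes> w = y" using xG yG by (simp add: w_def flip: m_assoc)
    ultimately show False using y by simp
  qed
  with that[OF wD wp] show ?thesis by (simp add: C_def)
qed

text \<open>Either an element \<open>x\<close> of maximal order or an element \<open>w\<close> of
  order \<open>p\<close> outside \<open>powers x\<close> will do. If \<open>d\<close> were cocyclic
  with both, maximality would give \<open>d \<in> powers x\<close> and the prime order
  \<open>w \<in> powers d\<close>, hence \<open>w \<in> powers x\<close>.\<close>

lemma noncyclic_pgroup_not_cocyclic:
  assumes nil: "nilpotent_group G" and p: "Factorial_Ring.prime p" "odd p"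
    and D: "subgroup D G" "\<And>x. x \<in> D \<Longrightarrow> p_element p x" "\<And>g. g \<in> D \<Longrightarrow> D \<noteq> powers g"
    and d: "d \<in> D" "d \<noteq> \<one>"
  obtains z where "z \<in> D" "\<not> cocyclic d z"
proof -
  interpret D: subgroup D G by fact
  note inc = D.subset[THEN subsetD]
  have fD: "finite D" using finite_subgroup D(1) by blast
  have "Max (ord ` D) \<in> ord ` D" by (intro Max_in finite_imageI fD) (use D.one_closed in blast)
  then obtain x where x: "x \<in> D" "ord x = Max (ord ` D)" by auto
  have xm: "ord z \<le> ord x" if "z \<in> D" for z using that fD x by simp
  obtain w where w: "w \<in> D" "w [^] p = \<one>" "w \<notin> powers x"
    using noncyclic_pgroup_prime_order_element[OF nil p D x(1) xm] by blast
  have "\<not> cocyclic d x \<or> \<not> cocyclic d w"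
  proof (rule ccontr)
    assume "\<not> ?thesis"
    hence c: "d \<in> powers x \<or> x \<in> powers d" "d \<in> powers w \<or> w \<in> powers d"
      using cocyclic_p_element[OF p(1)] D(2) d x w by blast+
    have G: "x \<in> carrier G" "w \<in> carrier G" "d \<in> carrier G" using x w d inc by auto
    have "d \<in> powers x"
    proof (cases "x \<in> powers d")
      case True
      hence "powers x \<subseteq> powers d" using powers_mono G by blast
      moreover have "card (powers d) \<le> card (powers x)" using G d xm by (simp add: card_powers)
      ultimately have "powers x = powers d"
        using finite_subgroup[OF subgroup_powers[OF G(3)]] by (simp add: card_seteq)
      thus ?thesis using powers_self G by simp
    qed (use c in auto)
    moreover have "w \<in> powers d" using c generator_mem_powers_of_prime_order[OF p(1) G(2) w(2)] d by blast
    ultimately show False using w(3) powers_mono G by blast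
  qed
  thus ?thesis using that x w by blast
qed

text \<open>If the centraliser \<open>D\<close> of \<open>d\<close> in \<open>P\<close> is cyclic, everything outside \<open>D\<close> counts, and \<open>D\<close> has
  index at least 3. Otherwise take \<open>z \<in> D\<close> in no common cyclic subgroup with \<open>d\<close>; then the cosets
  \<open>\<langle>d\<rangle>z\<close> and \<open>\<langle>d\<rangle>z\<^sup>-\<^sup>1\<close> count, and they are disjoint because \<open>p\<close> is odd.\<close>

lemma card_not_cocyclic_ge:
  assumes nil: "nilpotent_group G" and p: "Factorial_Ring.prime p" "odd p"
    and P: "subgroup P G" "\<And>x. x \<in> P \<Longrightarrow> p_element p x" "\<And>g. g \<in> P \<Longrightarrow> P \<noteq> powers g" "odd (card P)"
    and d: "d \<in> P" "d \<noteq> \<one>"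
  shows "2 * card (powers d) \<le> card {y\<in>P. \<not> cocyclic d y}"
proof -
  interpret P: subgroup P G by fact
  note inc = P.subset[THEN subsetD]
  have fP: "finite P" using finite_subgroup P(1) by blast
  have dG: "d \<in> carrier G" using d inc by auto
  define D where "D = {y\<in>P. d \<otimes> y = y \<otimes> d}"
  have D: "subgroup D G"
  proof (rule subgroup_finiteI)
    fix x y assume "x \<in> D" "y \<in> D"
    moreover from this have "x \<in> carrier G" "y \<in> carrier G" using inc by (auto simp: D_def)
    moreover from calculation have "d \<otimes> (x \<otimes> y) = (x \<otimes> y) \<otimes> d"
      using dG unfolding D_def by (metis (mono_tags, lifting) m_assoc mem_Collect_eq)
    ultimately show "x \<otimes> y \<in> D" by (simp add: D_def)
  qed (use inc dG in \<open>auto simp: D_def\<close>)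
  have dD: "d \<in> D" using d by (simp add: D_def)
  have DP: "D \<subseteq> P" by (auto simp: D_def)
  show ?thesis
  proof (cases "\<exists>g\<in>D. D = powers g")
    case True
    hence "D \<noteq> P" using P(3) by (auto simp: D_def)
    hence "card D < card P" using DP fP by (simp add: psubset_card_mono psubsetI)
    moreover obtain k where k: "card P = card D * k" using card_subgroup_dvd[OF D P(1) DP] by (auto simp: dvd_def)
    ultimately have "odd k" "k \<noteq> 1" using P(4) by auto
    hence "3 \<le> k" by (auto elim!: oddE)
    hence "3 * card D \<le> card P" using k by simp
    hence "2 * card D \<le> card (P - D)" using fP DP by (simp add: card_Diff_subset finite_subset)
    also have "\<dots> \<le> card {y\<in>P. \<not> cocyclic d y}"
      by (intro card_mono) (use fP cocyclic_commute in \<open>auto simp: D_def\<close>)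
    finally show ?thesis
      using card_mono[OF finite_subset[OF DP fP] powers_subset[OF D dD]] by simp
  next
    case False
    obtain z where z: "z \<in> D" "\<not> cocyclic d z"
      using noncyclic_pgroup_not_cocyclic[OF nil p D _ _ dD d(2)] P(2) False by (auto simp: D_def)
    have zP: "z \<in> P" and zG: "z \<in> carrier G" using z inc by (auto simp: D_def)
    define L where "L y = (\<lambda>x. x \<otimes> y) ` powers d" for y
    have sd: "subgroup (powers d) G" using subgroup_powers dG by blast
    interpret d: subgroup "powers d" G by fact
    have dsub: "powers d \<subseteq> P" using powers_subset[OF P(1) d(1)] .
    have cL: "card (L y) = card (powers d)" if "y \<in> carrier G" for y
      unfolding L_def using that d.subset by (intro card_image inj_onI) auto
    \<comment> \<open>The condition \<open>z \<in> powers y\<close> covers both cosets,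
      \<open>y = z\<close> and \<open>y = inv z\<close>. A cyclic subgroup with \<open>d\<close> and
      \<open>x \<otimes> y\<close> contains \<open>x\<close>, hence \<open>y\<close>, hence
      \<open>z\<close>.\<close>
    have sub: "L y \<subseteq> {y\<in>P. \<not> cocyclic d y}" if y: "y \<in> P" "z \<in> powers y" for y
    proof
      fix m assume "m \<in> L y"
      then obtain x where x: "x \<in> powers d" "m = x \<otimes> y" by (auto simp: L_def)
      have xP: "x \<in> P" "x \<in> carrier G" using x dsub inc by auto
      have "\<not> cocyclic d m"
      proof
        assume "cocyclic d m"
        then obtain g where g: "g \<in> carrier G" "d \<in> powers g" "m \<in> powers g" by (auto simp: cocyclic_def)
        interpret g: subgroup "powers g" G using subgroup_powers g by simp
        have "x \<in> powers g" using powers_mono[OF g(2,1)] x by auto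
        hence "inv x \<otimes> m \<in> powers g" using g by simp
        moreover have "inv x \<otimes> m = y" using x xP y inc by (simp flip: m_assoc)
        ultimately have "z \<in> powers g" using powers_mono[of y g] g y by auto
        thus False using z g by (auto simp: cocyclic_def)
      qed
      thus "m \<in> {y\<in>P. \<not> cocyclic d y}" using x xP y by auto
    qed
    have zi: "z \<in> powers (inv z)"
      using subgroup.m_inv_closed[OF subgroup_powers powers_self, of "inv z"] zG by simp
    have disj: "L z \<inter> L (inv z) = {}"
    proof (rule ccontr)
      assume "L z \<inter> L (inv z) \<noteq> {}"
      then obtain a b where ab: "a \<in> powers d" "b \<in> powers d" "a \<otimes> z = b \<otimes> inv z" by (auto simp: L_def)
      have abG: "a \<in> carrier G" "b \<in> carrier G" using ab d.subset by auto
      have "a \<otimes> (z \<otimes> z) = b" using ab abG zG by (metis inv_solve_right' m_assoc m_closed)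
      hence "z [^] (2::nat) = inv a \<otimes> b" using abG zG by (auto simp: numeral_2_eq_2 simp flip: m_assoc)
      hence z2: "z [^] (2::nat) \<in> powers d" using ab by simp
      obtain e where e: "z [^] (p ^ e) = \<one>" using P(2)[OF zP] by (auto simp: p_element_def)
      have "z \<in> powers (z [^] (2::nat))"
        using p by (intro powers_pow_coprime[OF zG e]) (simp add: coprime_left_2_iff_odd)
      hence "z \<in> powers d" using powers_mono[OF z2 dG] by blast
      thus False using z cocyclic_powers cocyclic_sym dG by blast
    qed
    have "2 * card (powers d) = card (L z \<union> L (inv z))"
      using disj cL zG finite_subgroup[OF sd] by (subst card_Un_disjoint) (auto simp: L_def)
    also have "\<dots> \<le> card {y\<in>P. \<not> cocyclic d y}"
      by (intro card_mono) (use fP sub[OF zP powers_self[OF zG]] sub[OF _ zi] zP in auto)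
    finally show ?thesis .
  qed
qed

end

section \<open>Sylow subgroups of nilpotent groups as direct factors\<close>

context finite_group
begin

lemma pow_card_subgroup:
  assumes "subgroup P G" "x \<in> P"
  shows "x [^] card P = \<one>"
proof -
  have xG: "x \<in> carrier G" using assms subgroup.subset by blast
  have "card (powers x) dvd card P"
    using assms subgroup_powers[OF xG] powers_subset by (intro card_subgroup_dvd) auto
  thus ?thesis using xG by (simp add: card_powers pow_eq_id)
qed

lemma sylow_subgroup_exists:
  assumes "Factorial_Ring.prime q"
  obtains Q where "sylow_subgroup q Q G"
proof -
  define a where "a = multiplicity q (Coset.order G)"
  have "q ^ a dvd Coset.order G" unfolding a_def by (rule multiplicity_dvd)
  then obtain m where "Coset.order G = q ^ a * m" by (auto simp: dvd_def)
  hence "sylow G q a m" using assms fin is_group by (simp add: sylow_eq sylow_axioms_def)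
  from sylow.sylow_thm[OF this] show ?thesis using that by (auto simp: sylow_subgroup_def a_def)
qed

lemma order_pos: "0 < Coset.order G"
  using fin by (simp add: order_gt_0_iff_finite)

text \<open>Elements of coprime orders commute, so the normaliser of \<open>P\<close> contains a Sylow subgroup for
  every prime.\<close>

lemma nilpotent_sylow_normal:
  assumes nil: "nilpotent_group G" and p: "Factorial_Ring.prime p" and P: "sylow_subgroup p P G"
  shows "P \<lhd> G"
proof -
  have sP: "subgroup P G" and cP: "card P = p ^ multiplicity p (Coset.order G)"
    using P by (auto simp: sylow_subgroup_def)
  interpret P: subgroup P G by fact
  note inc = P.subset[THEN subsetD]
  define K where "K = {g \<in> carrier G. \<forall>x\<in>P. g \<otimes> x \<otimes> inv g \<in> P}"
  have K: "subgroup K G"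
  proof (rule subgroup_finiteI)
    fix g h assume gh: "g \<in> K" "h \<in> K"
    have "g \<otimes> h \<otimes> x \<otimes> inv (g \<otimes> h) \<in> P" if x: "x \<in> P" for x
    proof -
      have "g \<otimes> h \<otimes> x \<otimes> inv (g \<otimes> h) = g \<otimes> (h \<otimes> x \<otimes> inv h) \<otimes> inv g"
        using gh x inc by (simp add: K_def inv_mult_group m_assoc)
      thus ?thesis using gh x by (simp add: K_def)
    qed
    thus "g \<otimes> h \<in> K" using gh by (simp add: K_def)
  qed (use inc in \<open>auto simp: K_def\<close>)
  have "P \<subseteq> K" using inc by (auto simp: K_def)
  have "multiplicity q (Coset.order G) \<le> multiplicity q (card K)" if q: "Factorial_Ring.prime q" for q
  proof -
    obtain Q where "sylow_subgroup q Q G" using sylow_subgroup_exists[OF q] .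
    hence Q: "subgroup Q G" "card Q = q ^ multiplicity q (Coset.order G)" by (auto simp: sylow_subgroup_def)
    have "\<exists>L. subgroup L G \<and> L \<subseteq> K \<and> card L = q ^ multiplicity q (Coset.order G)"
    proof (cases "q = p")
      case True thus ?thesis using sP \<open>P \<subseteq> K\<close> cP by blast
    next
      case False
      have "Q \<subseteq> K"
      proof
        fix g assume g: "g \<in> Q"
        have gG: "g \<in> carrier G" using g Q subgroup.subset by blast
        have "g \<otimes> x \<otimes> inv g = x" if x: "x \<in> P" for x
        proof -
          have "coprime (card Q) (card P)" unfolding Q cP using False p q
            by (simp add: primes_coprime)
          hence "g \<otimes> x = x \<otimes> g"
            using nilpotent_coprime_commute[OF nil gG inc[OF x] pow_card_subgroup[OF Q(1) g] pow_card_subgroup[OF sP x]]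
            by simp
          thus ?thesis using gG inc[OF x] by (simp add: m_assoc)
        qed
        thus "g \<in> K" using gG by (simp add: K_def)
      qed
      thus ?thesis using Q by blast
    qed
    then obtain L where "subgroup L G" "L \<subseteq> K" "card L = q ^ multiplicity q (Coset.order G)" by blast
    hence "q ^ multiplicity q (Coset.order G) dvd card K" using card_subgroup_dvd K by metis
    moreover have "card K \<noteq> 0" using finite_subgroup[OF K] subgroup.one_closed[OF K] by auto
    ultimately show ?thesis using q by (intro multiplicity_geI) auto
  qed
  hence "Coset.order G dvd card K" using order_pos by (intro multiplicity_le_imp_dvd) auto
  moreover have "card K > 0" using finite_subgroup[OF K] subgroup.one_closed[OF K] by (auto simp: card_gt_0_iff)
  ultimately have "card (carrier G) \<le> card K" by (simp add: Coset.order_def dvd_imp_le)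
  hence "K = carrier G" using fin subgroup.subset[OF K] by (intro card_seteq) auto
  thus ?thesis by (intro normal_invI[OF sP]) (auto simp: K_def)
qed

lemma pow_normal_index:
  assumes "N \<lhd> G" "x \<in> carrier G"
  shows "x [^] (card (rcosets N)) \<in> N"
proof -
  interpret N: normal N G by fact
  interpret Q: group "G Mod N" by (rule N.factorgroup_is_group)
  have hom: "(\<lambda>a. N #> a) \<in> hom G (G Mod N)" by (rule N.r_coset_hom_Mod)
  interpret h: group_hom G "G Mod N" "\<lambda>a. N #> a" using hom by unfold_locales
  have "N #> x \<in> carrier (G Mod N)" using assms by simp
  from Q.pow_order_eq_1[OF this] have "N #> (x [^] (card (rcosets N))) = \<one>\<^bsub>G Mod N\<^esub>"
    using h.hom_nat_pow[OF assms(2)] by (simp add: Coset.order_def FactGroup_def)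
  hence "N #> (x [^] (card (rcosets N))) = N" by (simp add: FactGroup_def)
  thus ?thesis using coset_join1 N.is_subgroup assms by blast
qed

text \<open>The power map \<open>y \<mapsto> y\<^sup>k\<close> is the projection of a nilpotent group onto its Sylow
  \<open>p\<close>-subgroup \<open>P\<close>, and \<open>c\<close> is the common size of its fibres.\<close>

definition sylow_projection :: "nat \<Rightarrow> 'a set \<Rightarrow> nat \<Rightarrow> nat \<Rightarrow> bool" where
  "sylow_projection p P k c \<longleftrightarrow> subgroup P G \<and> (\<forall>x\<in>P. p_element p x) \<and> c > 0 \<and>
     (\<forall>y\<in>carrier G. y [^] k \<in> P) \<and>
     (\<forall>A\<subseteq>P. card {y \<in> carrier G. y [^] k \<in> A} = card A * c) \<and>
     (\<forall>y\<in>carrier G. y [^] k = \<one> \<longrightarrow> \<not> p dvd ord y)"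

lemma sylow_projectionD:
  assumes "sylow_projection p P k c"
  shows "subgroup P G" "\<And>x. x \<in> P \<Longrightarrow> p_element p x" "c > 0"
    "\<And>y. y \<in> carrier G \<Longrightarrow> y [^] k \<in> P"
    "\<And>A. A \<subseteq> P \<Longrightarrow> card {y \<in> carrier G. y [^] k \<in> A} = card A * c"
    "\<And>y. \<lbrakk>y \<in> carrier G; y [^] k = \<one>\<rbrakk> \<Longrightarrow> \<not> p dvd ord y"
  using assms by (auto simp: sylow_projection_def)

text \<open>The exponent \<open>k = r * u\<close> is 0 modulo the index \<open>r\<close> of
  \<open>P\<close> and 1 modulo \<open>p ^ a\<close>. So it kills the complement \<open>Z\<close>
  and fixes \<open>P\<close>, whose elements commute with those of \<open>Z\<close>; the fibres are
  the translates of \<open>Z\<close>.\<close>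

lemma nilpotent_sylow_projection:
  assumes nil: "nilpotent_group G" and p: "Factorial_Ring.prime p" and P: "sylow_subgroup p P G"
  shows "\<exists>k c. sylow_projection p P k c"
proof -
  define a where "a = multiplicity p (Coset.order G)"
  have sP: "subgroup P G" and cP: "card P = p ^ a"
    using P by (auto simp: sylow_subgroup_def a_def)
  interpret P: subgroup P G by fact
  note inc = P.subset[THEN subsetD]
  define r where "r = card (rcosets P)"
  have ord: "Coset.order G = p ^ a * r" using lagrange[OF sP] by (simp add: r_def cP mult.commute)
  have "\<not> p dvd r"
  proof
    assume "p dvd r"
    hence "p ^ Suc a dvd Coset.order G" using ord by (metis mult_dvd_mono dvd_refl power_Suc2)
    hence "Suc a \<le> multiplicity p (Coset.order G)"
      using order_pos p by (intro multiplicity_geI) auto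
    thus False by (simp add: a_def)
  qed
  hence cop: "coprime r (p ^ a)" using prime_imp_coprime[OF p] coprime_commute coprime_power_right_iff by blast
  have r0: "r > 0" using order_pos ord by auto
  obtain u v where uv: "r * u = p ^ a * v + 1" using coprime_inverse_exponent[OF cop r0] .
  define k where "k = r * u"
  define Z where "Z = {z \<in> carrier G. z [^] r = \<one>}"
  define N where "N = Coset.order G"
  have N: "y [^] (N * j) = \<one>" if "y \<in> carrier G" for y and j :: nat
    using that pow_order_eq_1[OF that] by (simp add: N_def flip: nat_pow_pow)
  have kP: "y [^] k \<in> P" if y: "y \<in> carrier G" for y
    using pow_in_subgroup[OF sP pow_normal_index[OF nilpotent_sylow_normal[OF nil p P] y], of u] y
    by (simp add: k_def r_def nat_pow_pow)
  have xP: "x [^] (p ^ a) = \<one>" if "x \<in> P" for x using pow_card_subgroup[OF sP that] by (simp add: cP)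
  have proj: "(x \<otimes> z) [^] k = x" if xz: "x \<in> P" "z \<in> Z" for x z
  proof -
    have G: "x \<in> carrier G" "z \<in> carrier G" "z [^] r = \<one>" using xz inc by (auto simp: Z_def)
    have "x \<otimes> z = z \<otimes> x"
      using nilpotent_coprime_commute[OF nil G(1,2) xP[OF xz(1)] G(3)] cop by (simp add: coprime_commute)
    hence "(x \<otimes> z) [^] k = x [^] k \<otimes> z [^] k" by (rule pow_mult_distrib[OF _ G(1,2)])
    also have "x [^] k = x" unfolding k_def uv using pow_period[OF G(1) xP[OF xz(1)], of v 1] G by simp
    also have "z [^] k = \<one>" unfolding k_def using G by (simp flip: nat_pow_pow)
    finally show ?thesis using G by simp
  qed
  have dec: "\<exists>z\<in>Z. y = y [^] k \<otimes> z" if y: "y \<in> carrier G" for y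
  proof
    \<comment> \<open>A nonnegative exponent congruent to \<open>1 - k\<close> modulo the group
      order, with \<open>N - 1\<close> standing for -1.\<close>
    define e where "e = p ^ a * v * (N - 1)"
    have "k + e = N * (p ^ a * v) + 1"
    proof -
      obtain M where M: "N = Suc M" using order_pos gr0_implies_Suc by (auto simp: N_def)
      show ?thesis by (simp add: k_def uv e_def M algebra_simps)
    qed
    hence "y [^] k \<otimes> y [^] e = y"
      using pow_period[OF y, of N "p ^ a * v" 1] N[OF y, of 1] y by (simp add: nat_pow_mult)
    thus "y = y [^] k \<otimes> y [^] e" by simp
    have "e * r = (p ^ a * r) * (v * (N - 1))" by (simp add: e_def)
    also have "\<dots> = N * (v * (N - 1))" by (simp add: N_def ord)
    finally have "e * r = N * (v * (N - 1))" .
    thus "y [^] e \<in> Z" using y N[OF y] by (simp add: Z_def nat_pow_pow)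
  qed
  have fZ: "finite Z" using fin by (simp add: Z_def)
  have "\<one> \<in> Z" by (simp add: Z_def)
  hence cZ: "card Z > 0" using fZ by (auto simp: card_gt_0_iff)
  have fib: "card {y \<in> carrier G. y [^] k \<in> A} = card A * card Z" if A: "A \<subseteq> P" for A
  proof -
    have "{y \<in> carrier G. y [^] k \<in> A} = (\<lambda>(x, z). x \<otimes> z) ` (A \<times> Z)"
    proof (intro equalityI subsetI)
      fix y assume y: "y \<in> {y \<in> carrier G. y [^] k \<in> A}"
      then obtain z where "z \<in> Z" "y = y [^] k \<otimes> z" using dec by auto
      thus "y \<in> (\<lambda>(x, z). x \<otimes> z) ` (A \<times> Z)" using y by (intro image_eqI[of _ _ "(y [^] k, z)"]) auto
    next
      fix y assume "y \<in> (\<lambda>(x, z). x \<otimes> z) ` (A \<times> Z)"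
      then obtain x z where "x \<in> A" "z \<in> Z" "y = x \<otimes> z" by auto
      thus "y \<in> {y \<in> carrier G. y [^] k \<in> A}" using A proj[of x z] inc by (auto simp: Z_def)
    qed
    moreover have "inj_on (\<lambda>(x, z). x \<otimes> z) (A \<times> Z)"
    proof (rule inj_onI, clarify)
      fix x z x' z' assume h: "x \<in> A" "z \<in> Z" "x' \<in> A" "z' \<in> Z" "x \<otimes> z = x' \<otimes> z'"
      hence "x = x'" using proj A by (metis subsetD)
      moreover have "x \<in> carrier G" "z \<in> carrier G" "z' \<in> carrier G" using h A inc by (auto simp: Z_def)
      ultimately show "x = x' \<and> z = z'" using h(5) by simp
    qed
    ultimately show ?thesis by (simp add: card_image card_cartesian_product)
  qed
  have nd: "\<not> p dvd ord y" if y: "y \<in> carrier G" "y [^] k = \<one>" for y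
  proof -
    obtain z where z: "z \<in> Z" "y = y [^] k \<otimes> z" using dec[OF y(1)] by blast
    hence "y [^] r = \<one>" using y(2) by (simp add: Z_def)
    hence "ord y dvd r" using y pow_eq_id by blast
    thus ?thesis using \<open>\<not> p dvd r\<close> dvd_trans by blast
  qed
  have pel: "p_element p x" if "x \<in> P" for x using xP inc that by (auto simp: p_element_def)
  have "sylow_projection p P k (card Z)" unfolding sylow_projection_def
    by (intro conjI ballI allI impI sP cZ) (assumption | rule pel kP fib nd)+
  thus ?thesis by blast
qed

lemma cocyclic_pow: "cocyclic x y \<Longrightarrow> cocyclic (x [^] (k::nat)) (y [^] k)"
  unfolding cocyclic_def using pow_in_subgroup subgroup_powers by metis

lemma not_powers_if_not_cyclic:
  assumes "subgroup P G" "\<not> cyclic_group (subgroup_generated G P)" "g \<in> P"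
  shows "P \<noteq> powers g"
proof
  assume Pg: "P = powers g"
  have gG: "g \<in> carrier G" using assms subgroup.subset by blast
  have "subgroup_generated G P = subgroup_generated G {g}"
    using subgroup.carrier_subgroup_generated_subgroup[OF assms(1)] powers_eq_generate[OF gG] gG Pg
    by (simp add: subgroup_generated_def)
  thus False using assms(2) cyclic_group_generated by simp
qed

text \<open>The power map preserves common cyclic subgroups, so each obstruction found in
  \<open>P\<close> lifts to all \<open>c\<close> elements of its fibre.\<close>

lemma sylow_projection_not_cocyclic:
  assumes P: "sylow_projection p P k c" and y: "y \<in> carrier G"
  shows "card {w\<in>P. \<not> cocyclic (y [^] k) w} * c \<le> card {w\<in>carrier G. \<not> cocyclic y w}"
proof -
  have "card {w\<in>P. \<not> cocyclic (y [^] k) w} * c = card {w \<in> carrier G. w [^] k \<in> {w\<in>P. \<not> cocyclic (y [^] k) w}}"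
    by (rule sylow_projectionD(5)[OF P, symmetric]) auto
  also have "\<dots> \<le> card {w\<in>carrier G. \<not> cocyclic y w}"
    by (rule card_mono) (use fin cocyclic_pow in auto)
  finally show ?thesis .
qed

end

section \<open>Degrees in the non-cyclic graph\<close>

locale odd_nilpotent_noncyclic_sylow = finite_group +
  assumes nil: "nilpotent_group G" and odd_order: "odd (Coset.order G)"
    and no_cyclic: "no_cyclic_sylow_subgroups G"
begin

lemma sylow_projection_exists:
  assumes p: "Factorial_Ring.prime p" "p dvd Coset.order G"
  shows "\<exists>P k c. sylow_projection p P k c \<and>
    (\<forall>d\<in>P. d \<noteq> \<one> \<longrightarrow> 2 * card (powers d) \<le> card {y\<in>P. \<not> cocyclic d y})"
proof -
  obtain P where P: "sylow_subgroup p P G" using sylow_subgroup_exists[OF p(1)] .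
  obtain k c where proj: "sylow_projection p P k c" using nilpotent_sylow_projection[OF nil p(1) P] by blast
  note sP = sylow_projectionD(1)[OF proj]
  have nc: "P \<noteq> powers g" if "g \<in> P" for g
    using not_powers_if_not_cyclic[OF sP _ that] no_cyclic p P by (auto simp: no_cyclic_sylow_subgroups_def)
  have "odd p" using p odd_order dvd_trans by blast
  moreover have "card P dvd Coset.order G" using lagrange[OF sP] by (metis dvd_triv_right)
  hence "odd (card P)" using odd_order dvd_trans by blast
  ultimately have "2 * card (powers d) \<le> card {y\<in>P. \<not> cocyclic d y}" if "d \<in> P" "d \<noteq> \<one>" for d
    by (intro card_not_cocyclic_ge[OF nil p(1) _ sP sylow_projectionD(2)[OF proj] nc _ that])
  with proj show ?thesis by blast
qed

lemma prime_divisor_order: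
  assumes "x \<in> carrier G" "x \<noteq> \<one>"
  obtains p where "Factorial_Ring.prime p" "p dvd ord x" "p dvd Coset.order G"
proof -
  have "ord x \<noteq> 1" using assms ord_eq_1D by blast
  then obtain p where "Factorial_Ring.prime p" "p dvd ord x" using prime_factor_nat by blast
  thus ?thesis using that ord_dvd_group_order[OF assms(1)] dvd_trans by blast
qed

text \<open>Used twice: it gives every nontrivial element a noncyclic partner, and it makes the
  graph large enough for a cycle. The 4 is twice the bound 2 for the order of a nontrivial
  \<open>p\<close>-component.\<close>

lemma card_not_cocyclic_ge_4:
  assumes x: "x \<in> carrier G" "x \<noteq> \<one>"
  shows "4 \<le> card {y\<in>carrier G. \<not> cocyclic x y}"
proof -
  obtain p where p: "Factorial_Ring.prime p" "p dvd ord x" "p dvd Coset.order G"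
    using prime_divisor_order[OF x] .
  obtain P k c where P: "sylow_projection p P k c"
    and A: "\<And>d. \<lbrakk>d \<in> P; d \<noteq> \<one>\<rbrakk> \<Longrightarrow> 2 * card (powers d) \<le> card {y\<in>P. \<not> cocyclic d y}"
    using sylow_projection_exists[OF p(1,3)] by blast
  note h = sylow_projectionD[OF P]
  define d where "d = x [^] k"
  have d: "d \<in> P" "d \<noteq> \<one>" using h(4,6) x p by (auto simp: d_def)
  have dG: "d \<in> carrier G" using x by (simp add: d_def)
  have "{\<one>, d} \<subseteq> powers d" using powers_self[OF dG] subgroup.one_closed[OF subgroup_powers[OF dG]] by simp
  hence "card {\<one>, d} \<le> card (powers d)"
    using finite_subgroup[OF subgroup_powers[OF dG]] by (rule card_mono[rotated])
  hence "4 \<le> card {y\<in>P. \<not> cocyclic d y}" using A[OF d] d by simp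
  also have "\<dots> \<le> card {y\<in>P. \<not> cocyclic d y} * c" using h(3) by simp
  also have "\<dots> \<le> card {y\<in>carrier G. \<not> cocyclic x y}" unfolding d_def by (rule sylow_projection_not_cocyclic[OF P x(1)])
  finally show ?thesis .
qed

lemma posa_condition:
  assumes k: "2 * k < card (carrier G)" and x: "x \<in> carrier G" "x \<noteq> \<one>" "card {y\<in>carrier G. \<not> cocyclic x y} \<le> k"
  shows "card {h\<in>carrier G - {\<one>}. card {y\<in>carrier G. \<not> cocyclic h y} \<le> k} < k"
proof -
  obtain p where p: "Factorial_Ring.prime p" "p dvd ord x" "p dvd Coset.order G"
    using prime_divisor_order[OF x(1,2)] .
  obtain P m c where P: "sylow_projection p P m c"
    and A: "\<And>d. \<lbrakk>d \<in> P; d \<noteq> \<one>\<rbrakk> \<Longrightarrow> 2 * card (powers d) \<le> card {y\<in>P. \<not> cocyclic d y}"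
    using sylow_projection_exists[OF p(1,3)] by blast
  note h = sylow_projectionD[OF P]
  define L where "L = {h\<in>carrier G - {\<one>}. card {y\<in>carrier G. \<not> cocyclic h y} \<le> k}"
  have fL: "finite L" and xL: "x \<in> L" using fin x by (auto simp: L_def)
  have LG: "y \<in> carrier G" and Ld: "card {w\<in>P. \<not> cocyclic (y [^] m) w} * c \<le> k" if "y \<in> L" for y
    using that sylow_projection_not_cocyclic[OF P, of y] by (auto simp: L_def)
  have fP: "finite P" using finite_subgroup h(1) by blast
  have cG: "card (carrier G) = card P * c"
  proof -
    have "{y \<in> carrier G. y [^] m \<in> P} = carrier G" using h(4) by auto
    with h(5)[of P] show ?thesis by simp
  qed
  have cocL: "cocyclic (y [^] m) (z [^] m)" if yz: "y \<in> L" "z \<in> L" for y z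
  proof (rule ccontr)
    assume n: "\<not> cocyclic (y [^] m) (z [^] m)"
    have split: "card {w\<in>P. cocyclic d w} + card {w\<in>P. \<not> cocyclic d w} = card P" for d
    proof -
      have "{w\<in>P. cocyclic d w} \<union> {w\<in>P. \<not> cocyclic d w} = P" by blast
      moreover have "{w\<in>P. cocyclic d w} \<inter> {w\<in>P. \<not> cocyclic d w} = {}" by blast
      ultimately show ?thesis using fP by (metis (no_types, lifting) card_Un_disjoint finite_Un)
    qed
    have "card {w\<in>P. cocyclic (y [^] m) w} + card {w\<in>P. cocyclic (z [^] m) w} \<le> card P"
      using card_cocyclic_sum_le[OF p(1) h(1,2) h(4)[OF LG[OF yz(1)]] h(4)[OF LG[OF yz(2)]] n] by blast
    hence "card P \<le> card {w\<in>P. \<not> cocyclic (y [^] m) w} + card {w\<in>P. \<not> cocyclic (z [^] m) w}"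
      using split[of "y [^] m"] split[of "z [^] m"] by linarith
    hence "card P * c \<le> card {w\<in>P. \<not> cocyclic (y [^] m) w} * c + card {w\<in>P. \<not> cocyclic (z [^] m) w} * c"
      by (metis add_mult_distrib mult_le_mono1)
    also have "\<dots> \<le> 2 * k" using Ld[OF yz(1)] Ld[OF yz(2)] by linarith
    finally show False using k cG by simp
  qed
  have "Max ((\<lambda>y. ord (y [^] m)) ` L) \<in> (\<lambda>y. ord (y [^] m)) ` L"
    by (intro Max_in finite_imageI fL) (use xL in blast)
  then obtain y where y: "y \<in> L" "ord (y [^] m) = Max ((\<lambda>y. ord (y [^] m)) ` L)" by auto
  have ymax: "ord (z [^] m) \<le> ord (y [^] m)" if "z \<in> L" for z using that fL y(2) by simp
  define d where "d = y [^] m"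
  have dP: "d \<in> P" and dG: "d \<in> carrier G" using h(4) LG[OF y(1)] by (auto simp: d_def)
  \<comment> \<open>As \<open>p\<close> divides \<open>ord x\<close>, the low vertex
    \<open>x\<close> has a nontrivial component, so the largest component is nontrivial too.\<close>
  have d1: "d \<noteq> \<one>"
  proof
    assume "d = \<one>"
    hence "ord (x [^] m) \<le> 1" using ymax[OF xL] by (simp add: d_def)
    hence "x [^] m = \<one>" using ord_eq_1D[of "x [^] m"] ord_positive[of "x [^] m"] x(1) by simp
    thus False using h(6) x p by blast
  qed
  have fd: "finite (powers d)" using finite_subgroup[OF subgroup_powers[OF dG]] .
  have "z [^] m \<in> powers d" if z: "z \<in> L" for z
  proof (cases "d \<in> powers (z [^] m)")
    case True
    have zG: "z [^] m \<in> carrier G" using LG[OF z] by simp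
    have "powers d \<subseteq> powers (z [^] m)" using powers_mono True zG by blast
    moreover have "card (powers (z [^] m)) \<le> card (powers d)"
      using ymax[OF z] zG dG by (simp add: card_powers d_def)
    ultimately have "powers d = powers (z [^] m)"
      using finite_subgroup[OF subgroup_powers[OF zG]] by (simp add: card_seteq)
    thus ?thesis using powers_self[OF zG] by simp
  next
    case False
    thus ?thesis
      using cocyclic_p_element[OF p(1) h(2)[OF dP] h(2)[OF h(4)[OF LG[OF z]]]] cocL[OF y(1) z] by (auto simp: d_def)
  qed
  hence "L \<subseteq> {z \<in> carrier G. z [^] m \<in> powers d}" using LG by blast
  hence "card L \<le> card {z \<in> carrier G. z [^] m \<in> powers d}" using fin by (intro card_mono) auto
  also have "\<dots> = card (powers d) * c" using powers_subset[OF h(1) dP] by (rule h(5))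
  finally have "card L \<le> card (powers d) * c" .
  \<comment> \<open>The element \<open>y\<close> with component \<open>d\<close> is itself low, so
    its degree bounds \<open>k\<close> from below.\<close>
  moreover have "2 * (card (powers d) * c) \<le> k"
    using mult_le_mono1[OF A[OF dP d1], of c] Ld[OF y(1)]
    unfolding d_def[symmetric] mult.assoc by linarith
  moreover have "card (powers d) * c > 0" using h(3) fd powers_self[OF dG] by (auto simp: card_gt_0_iff)
  ultimately show ?thesis unfolding L_def by linarith
qed

end

section \<open>Common cyclic subgroups and cyclic two-generator subgroups\<close>

context finite_group
begin

lemma int_pow_in_powers: "g \<in> carrier G \<Longrightarrow> g [^] (n::int) \<in> powers g"
  using subgroup_powers powers_self subgroup_int_pow_closed by blast

lemma cocyclic_if_cyclic_group:
  assumes "cyclic_group (subgroup_generated G {x, y})" "x \<in> carrier G" "y \<in> carrier G"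
  shows "cocyclic x y"
proof -
  let ?S = "subgroup_generated G {x, y}"
  interpret S: group ?S by simp
  obtain g where g: "g \<in> carrier ?S" "carrier ?S = range (\<lambda>n::int. g [^]\<^bsub>?S\<^esub> n)"
    using assms(1) S.cyclic_group by blast
  have gG: "g \<in> carrier G" using g(1) carrier_subgroup_generated_subset by blast
  have "g [^]\<^bsub>?S\<^esub> n \<in> powers g" for n :: int
    unfolding int_pow_subgroup_generated[OF g(1)] by (rule int_pow_in_powers[OF gG])
  hence "carrier ?S \<subseteq> powers g" unfolding g(2) by blast
  moreover have "x \<in> carrier ?S" "y \<in> carrier ?S"
    using assms by (auto simp: carrier_subgroup_generated intro: generate.incl)
  ultimately show ?thesis using gG by (auto simp: cocyclic_def)
qed

text \<open>If \<open>x\<close> and \<open>y\<close> are the powers of \<open>g\<close> with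
  exponents \<open>i\<close> and \<open>j\<close>, Bezout's identity shows that the power with
  exponent \<open>gcd i j\<close> generates the same subgroup as the two together.\<close>

lemma cyclic_group_if_cocyclic:
  assumes "cocyclic x y"
  shows "cyclic_group (subgroup_generated G {x, y})"
proof -
  let ?S = "subgroup_generated G {x, y}"
  interpret S: group ?S by simp
  obtain g i j where g: "g \<in> carrier G" "x = g [^] (i::nat)" "y = g [^] (j::nat)"
    using assms by (auto simp: cocyclic_def powers_def)
  have xy: "x \<in> carrier G" "y \<in> carrier G" using g by auto
  have sS: "subgroup (carrier ?S) G" by (simp add: subgroup_subgroup_generated)
  have xyS: "x \<in> carrier ?S" "y \<in> carrier ?S"
    using xy unfolding carrier_subgroup_generated by (blast intro: generate.incl)+
  define h where "h = g [^] gcd i j"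
  have hG: "h \<in> carrier G" using g by (simp add: h_def)
  have "x = h [^] (i div gcd i j)" "y = h [^] (j div gcd i j)"
    unfolding h_def nat_pow_pow[OF g(1)] using g(2,3) by simp_all
  hence "{x, y} \<subseteq> powers h" by (simp add: pow_in_powers)
  hence sub: "carrier ?S \<subseteq> powers h"
    unfolding carrier_subgroup_generated
    by (intro generate_subgroup_incl[OF _ subgroup_powers[OF hG]]) blast
  have "h \<in> carrier ?S"
  proof (cases "i = 0")
    case True
    thus ?thesis using xyS g by (simp add: h_def)
  next
    case False
    then obtain u v where uv: "i * u = j * v + gcd i j" using bezout_nat by blast
    have "x [^] u = y [^] v \<otimes> h"
      unfolding g(2,3) h_def nat_pow_pow[OF g(1)] nat_pow_mult[OF g(1)] uv ..
    hence "h = inv (y [^] v) \<otimes> x [^] u" using xy hG by (simp flip: m_assoc)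
    moreover have "inv (y [^] v) \<in> carrier ?S" "x [^] u \<in> carrier ?S"
      using pow_in_subgroup[OF sS] subgroup.m_inv_closed[OF sS] xyS by blast+
    ultimately show ?thesis using subgroup.m_closed[OF sS] by metis
  qed
  moreover have "carrier ?S = range (\<lambda>n::int. h [^]\<^bsub>?S\<^esub> n)"
  proof
    show "carrier ?S \<subseteq> range (\<lambda>n::int. h [^]\<^bsub>?S\<^esub> n)"
    proof
      fix z assume "z \<in> carrier ?S"
      then obtain k where "z = h [^] (k::nat)" using sub by (auto simp: powers_def)
      hence "z = h [^]\<^bsub>?S\<^esub> int k"
        using int_pow_subgroup_generated[OF \<open>h \<in> carrier ?S\<close>, of "int k"] by (simp only: int_pow_int)
      thus "z \<in> range (\<lambda>n::int. h [^]\<^bsub>?S\<^esub> n)" by blast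
    qed
  qed (use \<open>h \<in> carrier ?S\<close> in auto)
  ultimately show ?thesis using S.cyclic_group by blast
qed

end

section \<open>The direct product with the cyclic factor\<close>

lemma nat_pow_DirProd: "x [^]\<^bsub>G \<times>\<times> H\<^esub> (k::nat) = (fst x [^]\<^bsub>G\<^esub> k, snd x [^]\<^bsub>H\<^esub> k)"
  by (induction k) (auto simp: DirProd_def split: prod.splits)

lemma cocyclic_DirProd_snd:
  assumes "finite_group H" "finite_group (K \<times>\<times> H)" "finite_group.cocyclic (K \<times>\<times> H) (a, x) (b, y)"
  shows "finite_group.cocyclic H x y"
proof -
  interpret H: finite_group H by fact
  interpret KH: finite_group "K \<times>\<times> H" by fact
  obtain g i j where "g \<in> carrier (K \<times>\<times> H)" "(a, x) = g [^]\<^bsub>K \<times>\<times> H\<^esub> (i::nat)" "(b, y) = g [^]\<^bsub>K \<times>\<times> H\<^esub> (j::nat)"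
    using assms(3) by (auto simp: KH.cocyclic_def KH.powers_def)
  hence "snd g \<in> carrier H" "x = snd g [^]\<^bsub>H\<^esub> i" "y = snd g [^]\<^bsub>H\<^esub> j"
    by (auto simp: nat_pow_DirProd)
  thus ?thesis unfolding H.cocyclic_def using H.pow_in_powers by blast
qed

text \<open>The element \<open>(1, y)\<close> generates a cyclic subgroup containing both. As
  \<open>n\<close> and the order of \<open>y\<close> are coprime, the Chinese remainder theorem
  prescribes an exponent independently in the two coordinates.\<close>

lemma cocyclic_integer_mod_group_DirProd:
  assumes H: "finite_group H" and KH: "finite_group (integer_mod_group n \<times>\<times> H)"
    and n: "n \<ge> 1" "coprime n (Coset.order H)"
    and a: "a \<in> carrier (integer_mod_group n)" and b: "b \<in> carrier (integer_mod_group n)"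
    and y: "y \<in> carrier H"
  shows "finite_group.cocyclic (integer_mod_group n \<times>\<times> H) (a, \<one>\<^bsub>H\<^esub>) (b, y)"
proof -
  interpret H: finite_group H by fact
  interpret KH: finite_group "integer_mod_group n \<times>\<times> H" by fact
  have cop: "coprime n (H.ord y)"
    using n(2) H.ord_dvd_group_order[OF y] coprime_divisors dvd_refl by blast
  have ab: "0 \<le> a" "a < int n" "0 \<le> b" "b < int n"
    using a b n(1) by (auto simp: carrier_integer_mod_group)
  \<comment> \<open>Reduction modulo \<open>n\<close> matters for \<open>n = 1\<close>, where the
    only residue is 0.\<close>
  define g where "g = (1 mod int n, y)"
  have gG: "g \<in> carrier (integer_mod_group n \<times>\<times> H)"
    using y n by (auto simp: g_def carrier_integer_mod_group)
  have g: "g [^]\<^bsub>integer_mod_group n \<times>\<times> H\<^esub> m = (int m mod int n, y [^]\<^bsub>H\<^esub> m)" for m :: nat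
    by (simp add: nat_pow_DirProd g_def pow_integer_mod_group mod_mult_right_eq)
  obtain i where i: "[i = nat a] (mod n)" "[i = 0] (mod H.ord y)"
    using binary_chinese_remainder_nat[OF cop] by blast
  obtain j where j: "[j = nat b] (mod n)" "[j = 1] (mod H.ord y)"
    using binary_chinese_remainder_nat[OF cop] by blast
  have "int i mod int n = a" using i(1) ab by (auto simp: cong_def nat_less_iff simp flip: zmod_int)
  moreover have "y [^]\<^bsub>H\<^esub> i = \<one>\<^bsub>H\<^esub>" using i(2) y by (simp add: H.pow_eq_id cong_0_iff)
  moreover have "int j mod int n = b" using j(1) ab by (auto simp: cong_def nat_less_iff simp flip: zmod_int)
  moreover have "y [^]\<^bsub>H\<^esub> j = y"
  proof -
    have "y [^]\<^bsub>H\<^esub> m = y [^]\<^bsub>H\<^esub> (m mod H.ord y)" for m :: nat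
      using H.pow_period[OF y H.pow_ord_eq_1[OF y], of "m div H.ord y" "m mod H.ord y"] by simp
    from this[of j] this[of 1] show ?thesis using j(2) y by (simp add: cong_def)
  qed
  ultimately have "(a, \<one>\<^bsub>H\<^esub>) = g [^]\<^bsub>integer_mod_group n \<times>\<times> H\<^esub> i" "(b, y) = g [^]\<^bsub>integer_mod_group n \<times>\<times> H\<^esub> j"
    by (simp_all add: g)
  thus ?thesis unfolding KH.cocyclic_def using KH.pow_in_powers gG by metis
qed

theorem theorem3p9:
  fixes n :: nat and H :: "('a, 'b) monoid_scheme"
  assumes "n \<ge> 1"
    and "group H" and "finite (carrier H)" and "\<not> trivial_group H"
    and "nilpotent_group H"
    and "odd (Coset.order H)"
    and "no_cyclic_sylow_subgroups H"
    and "coprime n (Coset.order H)"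
  shows "hamiltonian (noncyclic_graph (integer_mod_group n \<times>\<times> H))"
proof -
  let ?K = "integer_mod_group n \<times>\<times> H"
  let ?\<Gamma> = "noncyclic_graph ?K"
  interpret H: odd_nilpotent_noncyclic_sylow H
    using assms by (intro odd_nilpotent_noncyclic_sylow.intro finite_group.intro
        finite_group_axioms.intro odd_nilpotent_noncyclic_sylow_axioms.intro)
  have H: "finite_group H" by unfold_locales
  have K: "finite_group ?K"
    using assms(1,3)
    by (intro finite_group.intro finite_group_axioms.intro DirProd_group assms(2))
       (auto simp: carrier_integer_mod_group)
  interpret K: finite_group ?K by (rule K)
  have carrZ: "carrier (integer_mod_group n) = {0..<int n}"
    using assms(1) by (simp add: carrier_integer_mod_group)
  \<comment> \<open>Membership in the carrier is built in so that \<open>A\<close> is irreflexive on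
    the whole type, as \<open>posa_hamiltonian\<close> demands.\<close>
  define A where "A x y \<longleftrightarrow> x \<in> carrier H \<and> y \<in> carrier H \<and> \<not> H.cocyclic x y" for x y
  define V where "V = carrier H - {\<one>\<^bsub>H\<^esub>}"
  have fV: "finite V" using assms(3) by (simp add: V_def)
  have one: "\<not> A x \<one>\<^bsub>H\<^esub>" for x
    using H.cocyclic_powers[of "\<one>\<^bsub>H\<^esub>" x] subgroup.one_closed[OF H.subgroup_powers] H.cocyclic_sym
    by (auto simp: A_def)
  \<comment> \<open>The identity is adjacent to nothing, so the counts over the whole group in
    \<open>posa_condition\<close> are the degrees on \<open>V\<close>.\<close>
  have deg: "{y \<in> V. A x y} = {y \<in> carrier H. \<not> H.cocyclic x y}" if "x \<in> carrier H" for x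
    using that one by (auto simp: V_def A_def)
  have "V \<noteq> {}"
    using assms(4) H.one_closed by (auto simp: V_def trivial_group_def assms(2))
  then obtain x where x: "x \<in> carrier H" "x \<noteq> \<one>\<^bsub>H\<^esub>" by (auto simp: V_def)
  have "4 \<le> card {y \<in> V. A x y}" using H.card_not_cocyclic_ge_4[OF x] by (simp only: deg[OF x(1)])
  also have "\<dots> \<le> card V" using fV by (intro card_mono) auto
  finally have V3: "3 \<le> card V" by simp
  have "\<exists>xs. ham_cycle V A xs"
  proof (rule posa_hamiltonian[OF fV V3])
    fix k x assume k: "2 * k < card V" "x \<in> V" "card {y \<in> V. A x y} \<le> k"
    have "2 * k < card (carrier H)"
      using k(1) card_mono[of "carrier H" V] assms(3) by (auto simp: V_def)
    hence "card {h \<in> V. card {y \<in> carrier H. \<not> H.cocyclic h y} \<le> k} < k"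
      unfolding V_def using k deg[of x] by (intro H.posa_condition) (auto simp: V_def)
    moreover have "{h \<in> V. card {y \<in> V. A h y} \<le> k} = {h \<in> V. card {y \<in> carrier H. \<not> H.cocyclic h y} \<le> k}"
      using deg by (auto simp: V_def)
    ultimately show "card {x \<in> V. card {y \<in> V. A x y} \<le> k} < k" by simp
  qed (auto simp: A_def dest: H.cocyclic_sym H.cocyclic_refl)
  then obtain xs where xs: "ham_cycle V A xs" ..
  have not_cyclic: "\<not> cyclic_group (subgroup_generated ?K {(a, x), (b, y)})"
    if "a \<in> {0..<int n}" "b \<in> {0..<int n}" "A x y" for a b x y
    using K.cocyclic_if_cyclic_group[of "(a, x)" "(b, y)"] cocyclic_DirProd_snd[OF H K] that
    by (auto simp: A_def carrZ)
  \<comment> \<open>No further vertices drop out: for nontrivial \<open>x\<close>, a noncyclic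
    partner of \<open>(a, x)\<close> exists already with the same first coordinate.\<close>
  have "cyclicizer ?K = {0..<int n} \<times> {\<one>\<^bsub>H\<^esub>}"
  proof (intro equalityI subsetI)
    fix z assume "z \<in> cyclicizer ?K"
    then obtain a x where z: "z = (a, x)" "a \<in> {0..<int n}" "x \<in> carrier H"
      and cyc: "\<And>w. w \<in> carrier ?K \<Longrightarrow> cyclic_group (subgroup_generated ?K {(a, x), w})"
      by (auto simp: cyclicizer_def carrZ)
    have "x = \<one>\<^bsub>H\<^esub>"
    proof (rule ccontr)
      assume "x \<noteq> \<one>\<^bsub>H\<^esub>"
      from H.card_not_cocyclic_ge_4[OF z(3) this] have "{y \<in> carrier H. \<not> H.cocyclic x y} \<noteq> {}" by force
      then obtain y where "A x y" using z by (auto simp: A_def)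
      with not_cyclic[OF z(2) z(2) this] cyc[of "(a, y)"] z show False by (auto simp: A_def carrZ)
    qed
    with z show "z \<in> {0..<int n} \<times> {\<one>\<^bsub>H\<^esub>}" by simp
  next
    fix z assume "z \<in> {0..<int n} \<times> {\<one>\<^bsub>H\<^esub>}"
    then obtain a where z: "z = (a, \<one>\<^bsub>H\<^esub>)" "a \<in> {0..<int n}" by auto
    have "cyclic_group (subgroup_generated ?K {z, w})" if w: "w \<in> carrier ?K" for w
    proof -
      obtain b y where "w = (b, y)" "b \<in> {0..<int n}" "y \<in> carrier H" using w by (auto simp: carrZ)
      thus ?thesis using z assms(1,8)
        by (auto intro!: K.cyclic_group_if_cocyclic cocyclic_integer_mod_group_DirProd[OF H K]
            simp: carrZ)
    qed
    thus "z \<in> cyclicizer ?K" using z by (auto simp: cyclicizer_def carrZ)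
  qed
  hence verts: "pverts ?\<Gamma> = int ` {..<n} \<times> V"
    by (auto simp: noncyclic_graph_def carrZ V_def image_int_atLeastLessThan lessThan_atLeast0)
  have "ham_cycle (int ` {..<n} \<times> V) (\<lambda>p q. (p, q) \<in> parcs ?\<Gamma>)
      (List.product (map int [0..<n]) xs)"
  proof (rule ham_cycle_blow_up[OF xs assms(1)])
    fix a b x y assume h: "a < n" "b < n" "x \<in> V" "y \<in> V" "A x y"
    have "(int a, x) \<in> pverts ?\<Gamma>" "(int b, y) \<in> pverts ?\<Gamma>" using h by (auto simp: verts)
    moreover have "x \<noteq> y" using h H.cocyclic_refl by (auto simp: A_def)
    ultimately show "((int a, x), (int b, y)) \<in> parcs ?\<Gamma>"
      using not_cyclic[of "int a" "int b" x y] h by (auto simp: noncyclic_graph_def)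
  qed simp
  thus ?thesis by (intro hamiltonian_if_ham_cycle) (simp only: verts)
qed

end
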